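(* Let $R$ be $\mathbb{Z}$ or a field of characteristic $0$, let $(\mathbf{x},\rho,B)$ be a generalized seed over $R$, and let $\mathcal{U}=\mathcal{U}(\mathbf{x},\rho,B)$ be the generalized upper cluster algebra associated to it. Assume that $\mathcal{U}=S_{\mathbf{y}}$ for some cluster $\mathbf{y}=\{y_1,\dots,y_{n+m}\}$ (the cluster of a generalized seed mutation-equivalent to $(\mathbf{x},\rho,B)$). Then $\mathcal{U}$ is factorial (a UFD) if and only if the exchange polynomials $f_i=y_iy_i'\in R[\mathbf{y}]$, $i\in[1,n]$, associated to this seed are irreducible.
   Context: Here $[a,b]$ denotes the set of integers $x$ with $a\le x\le b$; $[x]_+=\max(x,0)$; $\mathbf{q}(R)$ is the quotient field of $R$. Let $n,m\ge 0$ be integers with $n+m>0$, and let the ambient field $\mathcal{F}$ be the rational function field in $n+m$ independent variables over $\mathbf{q}(R)$. An exchange matrix is an $(n+m)\times n$ integer matrix $B=(b_{ij})$ whose submatrix on the first $n$ rows is skew-symmetrizable, i.e. becomes skew-symmetric after left multiplication by some diagonal matrix with positive integer diagonal entries. Fix positive integers $d_1,\dots,d_n$ such that $\beta_{ji}:=b_{ji}/d_i\in\mathbb{Z}$ for all $i\in[1,n]$, $j\in[1,n+m]$. A generalized seed of rank $n$ is a triple $(\mathbf{x},\rho,B)$ where $\mathbf{x}=\{x_1,\dots,x_{n+m}\}\subseteq\mathcal{F}$ is a cluster, i.e. a set of $n+m$ elements algebraically independent over $R$ ($x_1,\dots,x_n$ are the cluster variables and $x_{n+1},\dots,x_{n+m}$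 the frozen variables); $B$ is an exchange matrix; and $\rho=\{\rho_i\mid i\in[1,n]\}$ with $\rho_i=\{\rho_{i,0},\dots,\rho_{i,d_i}\}$, $\rho_{i,0}=\rho_{i,d_i}=1$ and $\rho_{i,j}$ a monomial (with coefficient in $R$) in $R[x_{n+1},\dots,x_{n+m}]$ for $j\in[1,d_i-1]$. Its exchange polynomials are, for $i\in[1,n]$, $$f_i=\sum_{j=0}^{d_i}\rho_{i,j}\prod_{k=1}^{n+m}x_k^{\,j[\beta_{ki}]_++(d_i-j)[-\beta_{ki}]_+}\in R[\mathbf{x}].$$ The mutation of $(\mathbf{x},\rho,B)$ in direction $i\in[1,n]$ is the generalized seed $\mu_i(\mathbf{x},\rho,B)=(\mathbf{x}_i,\rho',B_i)$ (with the same $d_1,\dots,d_n$), where $\mathbf{x}_i=(\mathbf{x}\setminus\{x_i\})\cup\{x_i'\}$ with $x_i'=f_i/x_i$; $\rho'$ is obtained from $\rho$ by replacing $\rho_i$ by $\rho_i'$, $\rho'_{i,j}=\rho_{i,d_i-j}$; and $B_i=(b'_{kl})$ with $b'_{kl}=-b_{kl}$ if $k=i$ or $l=i$, and $b'_{kl}=b_{kl}+[b_{il}]_+b_{ki}+b_{il}[-b_{ki}]_+$ otherwise. Two generalized seeds are mutation-equivalent if one is obtained from the other by a finite sequence of mutations. For a cluster $\mathbf{y}$, $L_{\mathbf{y}}=R[y_1^{\pm1},\dots,y_{n+m}^{\pm1}]$. The generalized upper cluster algebra $\mathcal{U}(\mathbf{x},\rho,B)$ is the intersection $\bigcap L_{\mathbf{y}}$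 over the clusters $\mathbf{y}$ of all generalized seeds mutation-equivalent to $(\mathbf{x},\rho,B)$. For a generalized seed with cluster $\mathbf{y}$, put $\mathbf{y}_0=\mathbf{y}$ and let $\mathbf{y}_i$ be the cluster obtained by mutating in direction $i\in[1,n]$; the upper bound is $S_{\mathbf{y}}=\bigcap_{i=0}^nL_{\mathbf{y}_i}$.
   Formalization: The formal statement also assumes that no exchange polynomial f_i of the seed is a unit of R[y] and that no y_k is a proper factor of any f_i (so f_i ≠ 0); without this it fails, e.g. R a field, n=1, m=0, d_1=1, B=(0), f_1=2. *)

theory Defs
  imports
    Complex_Main
    "HOL-Algebra.Algebraic_Closure_Type"
    "HOL-Algebra.Generated_Rings"
    "HOL-Algebra.Generated_Fields"
    "HOL-Algebra.Ring_Divisibility"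
begin

text \<open>
  The ambient field is a type \<open>'f\<close> of class \<open>field_char_0\<close>; the base ring and all rings attached to
  seeds are subsets of \<open>'f\<close>. Families indexed by \<open>[1,n]\<close> or \<open>[1,n+m]\<close> are functions on \<open>nat\<close>
  whose values outside the index range are irrelevant.
\<close>

abbreviation amb :: "'f::field ring" where
  "amb \<equiv> ring_of_type_algebra"

definition ring_on :: "'f::field set \<Rightarrow> 'f ring" where
  "ring_on S = amb\<lparr>carrier := S\<rparr>"

text \<open>
  Elements \<open>x 1, \<dots>, x N\<close> are algebraically independent over \<open>K\<close> if no nonzero polynomial with
  coefficients in \<open>K\<close> vanishes on them. Such a polynomial is given by a finite set \<open>A\<close> of exponent
  vectors and a coefficient \<open>c a\<close> for every \<open>a \<in> A\<close>.
\<close>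

definition alg_independent :: "'f::field set \<Rightarrow> nat \<Rightarrow> (nat \<Rightarrow> 'f) \<Rightarrow> bool" where
  "alg_independent K N x \<longleftrightarrow>
     (\<forall>A c. finite A \<longrightarrow> A \<subseteq> {1..N} \<rightarrow>\<^sub>E (UNIV :: nat set) \<longrightarrow> c ` A \<subseteq> K \<longrightarrow>
        (\<Sum>a\<in>A. c a * (\<Prod>k\<in>{1..N}. x k ^ a k)) = 0 \<longrightarrow> (\<forall>a\<in>A. c a = 0))"

text \<open>
  The whole type \<open>'f\<close> is the field of rational functions in \<open>N\<close> independent variables over the
  quotient field of \<open>R\<close>; the latter is the subfield generated by \<open>R\<close>.
\<close>

definition rational_function_field :: "'f::field set \<Rightarrow> nat \<Rightarrow> bool" where
  "rational_function_field R N \<longleftrightarrow>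
     (\<exists>z. alg_independent (generate_field amb R) N z \<and>
          generate_field amb (R \<union> z ` {1..N}) = (UNIV :: 'f set))"

definition polynomial_subring :: "'f::field set \<Rightarrow> nat \<Rightarrow> (nat \<Rightarrow> 'f) \<Rightarrow> 'f set" where
  "polynomial_subring R N x = generate_ring amb (R \<union> x ` {1..N})"

definition laurent_subring :: "'f::field set \<Rightarrow> nat \<Rightarrow> (nat \<Rightarrow> 'f) \<Rightarrow> 'f set" where
  "laurent_subring R N x = generate_ring amb (R \<union> x ` {1..N} \<union> (\<lambda>k. inverse (x k)) ` {1..N})"

text \<open>
  \<open>exmat s k i\<close> is the entry in row \<open>k\<close> and column \<open>i\<close>, and \<open>coef s i j\<close> is \<open>\<rho>\<^sub>i\<^sub>,\<^sub>j\<close>,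
  regarded as an element of the ambient field.
\<close>

record 'f gseed =
  clu :: "nat \<Rightarrow> 'f"
  coef :: "nat \<Rightarrow> nat \<Rightarrow> 'f"
  exmat :: "nat \<Rightarrow> nat \<Rightarrow> int"

definition skew_symmetrizable :: "nat \<Rightarrow> (nat \<Rightarrow> nat \<Rightarrow> int) \<Rightarrow> bool" where
  "skew_symmetrizable n B \<longleftrightarrow>
     (\<exists>\<delta> :: nat \<Rightarrow> int. (\<forall>i\<in>{1..n}. \<delta> i > 0) \<and>
        (\<forall>i\<in>{1..n}. \<forall>j\<in>{1..n}. \<delta> i * B i j = - (\<delta> j * B j i)))"

text \<open>A coefficient monomial may have coefficient \<open>0\<close>.\<close>

definition frozen_monomial :: "'f::field set \<Rightarrow> nat \<Rightarrow> nat \<Rightarrow> (nat \<Rightarrow> 'f) \<Rightarrow> 'f \<Rightarrow> bool" where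
  "frozen_monomial R n m x r \<longleftrightarrow>
     (\<exists>c\<in>R. \<exists>a :: nat \<Rightarrow> nat. r = c * (\<Prod>k\<in>{n+1..n+m}. x k ^ a k))"

definition generalized_seed ::
  "'f::field set \<Rightarrow> nat \<Rightarrow> nat \<Rightarrow> (nat \<Rightarrow> nat) \<Rightarrow> 'f gseed \<Rightarrow> bool" where
  "generalized_seed R n m d s \<longleftrightarrow>
     alg_independent R (n + m) (clu s) \<and>
     skew_symmetrizable n (exmat s) \<and>
     (\<forall>i\<in>{1..n}. \<forall>k\<in>{1..n+m}. int (d i) dvd exmat s k i) \<and>
     (\<forall>i\<in>{1..n}. coef s i 0 = 1 \<and> coef s i (d i) = 1 \<and>
        (\<forall>j\<in>{1..<d i}. frozen_monomial R n m (clu s) (coef s i j)))"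

text \<open>The truncating conversion \<open>nat\<close> from \<open>int\<close> plays the role of \<open>[\<cdot>]\<^sub>+\<close> in the exponents.\<close>

definition exchange_poly :: "nat \<Rightarrow> (nat \<Rightarrow> nat) \<Rightarrow> 'f::field gseed \<Rightarrow> nat \<Rightarrow> 'f" where
  "exchange_poly N d s i =
     (let \<beta> = (\<lambda>k. exmat s k i div int (d i)) in
      \<Sum>j\<in>{0..d i}. coef s i j *
        (\<Prod>k\<in>{1..N}. clu s k ^ (j * nat (\<beta> k) + (d i - j) * nat (- \<beta> k))))"

definition mutate_matrix :: "nat \<Rightarrow> (nat \<Rightarrow> nat \<Rightarrow> int) \<Rightarrow> nat \<Rightarrow> nat \<Rightarrow> int" where
  "mutate_matrix i B k l =
     (if k = i \<or> l = i then - B k l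
      else B k l + max (B i l) 0 * B k i + B i l * max (- B k i) 0)"

definition mutate :: "nat \<Rightarrow> (nat \<Rightarrow> nat) \<Rightarrow> nat \<Rightarrow> 'f::field gseed \<Rightarrow> 'f gseed" where
  "mutate N d i s =
     \<lparr>clu = (clu s)(i := exchange_poly N d s i / clu s i),
      coef = (coef s)(i := (\<lambda>j. coef s i (d i - j))),
      exmat = mutate_matrix i (exmat s)\<rparr>"

text \<open>
  If the exchange polynomial in direction \<open>i\<close> is zero, then mutation in direction \<open>i\<close> does not
  produce a generalized seed. Such steps are not mutations of generalized seeds, whence the
  premise on the mutated seed.
\<close>

inductive mutation_equivalent ::
  "'f::field set \<Rightarrow> nat \<Rightarrow> nat \<Rightarrow> (nat \<Rightarrow> nat) \<Rightarrow> 'f gseed \<Rightarrow> 'f gseed \<Rightarrow> bool"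
  for R n m d s where
    refl: "generalized_seed R n m d s \<Longrightarrow> mutation_equivalent R n m d s s"
  | step: "\<lbrakk>mutation_equivalent R n m d s t; i \<in> {1..n};
            generalized_seed R n m d (mutate (n + m) d i t)\<rbrakk>
           \<Longrightarrow> mutation_equivalent R n m d s (mutate (n + m) d i t)"

definition upper_cluster_algebra ::
  "'f::field set \<Rightarrow> nat \<Rightarrow> nat \<Rightarrow> (nat \<Rightarrow> nat) \<Rightarrow> 'f gseed \<Rightarrow> 'f set" where
  "upper_cluster_algebra R n m d s =
     (\<Inter>t\<in>{t. mutation_equivalent R n m d s t}. laurent_subring R (n + m) (clu t))"

definition upper_bound ::
  "'f::field set \<Rightarrow> nat \<Rightarrow> nat \<Rightarrow> (nat \<Rightarrow> nat) \<Rightarrow> 'f gseed \<Rightarrow> 'f set" where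
  "upper_bound R n m d s =
     laurent_subring R (n + m) (clu s) \<inter>
     (\<Inter>i\<in>{1..n}. laurent_subring R (n + m) (clu (mutate (n + m) d i s)))"

end

theory Submission
  imports Defs "HOL-Computational_Algebra.Polynomial"
begin

text \<open>
  Write \<open>P\<close> for the polynomial ring in the given cluster \<open>y\<close>, \<open>L\<close> for its Laurent ring,
  \<open>L' i\<close> for the Laurent ring of the cluster mutated in direction \<open>i\<close>, and
  \<open>S\<close> for the intersection of \<open>L\<close> with all \<open>L' i\<close>. By hypothesis \<open>S\<close> is the upper cluster algebra,
  so the question is when \<open>S\<close> is factorial. The exchange polynomial \<open>f i\<close> does not involve \<open>y i\<close>,
  because the diagonal of a skew-symmetrizable matrix vanishes; hence the mutated variable \<open>f i / y i\<close>
  is again transcendental over the polynomials in the other variables, and \<open>P\<close>, \<open>L\<close>, \<open>L' i\<close>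
  are all factorial by Gauss' lemma (\<open>gauss_ufd_adjoin\<close>) and localization (\<open>ufd_localization\<close>).
  
  Suppose the \<open>f i\<close> are irreducible in \<open>P\<close>, hence prime. Then \<open>f i\<close> is a prime or a unit of \<open>L' i\<close>
  (\<open>f_prime_L'\<close>). If it is a unit, then \<open>L' i\<close> contains \<open>L\<close> and imposes no condition on \<open>S\<close>. If it is
  prime, then so is its associate \<open>y i\<close> in \<open>L' i\<close>; since \<open>y i\<close> is invertible in all the other Laurent
  rings, it is prime in \<open>S\<close>. Inverting these prime elements of \<open>S\<close> gives the factorial ring \<open>L\<close>, and
  Nagata's theorem (\<open>nagata_ufd\<close>) shows that \<open>S\<close> is factorial. Two exchange polynomials may coincide
  here: the elements \<open>y i\<close> are told apart by the rings \<open>L' i\<close>, not by the \<open>f i\<close>.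
  
  Suppose conversely that \<open>S\<close> is factorial. If a cluster variable divides \<open>f i\<close>, the two are associated
  by hypothesis, and \<open>f i\<close> is prime. Otherwise \<open>y i\<close> is not a unit of \<open>S\<close>; a divisor of \<open>y i\<close> in \<open>S\<close> is a
  unit of \<open>L\<close>, thus a Laurent monomial, and comparing exponents shows that \<open>y i\<close> is irreducible
  (\<open>y_irreducible_S\<close>), hence prime in \<open>S\<close>. If \<open>f i = g * h\<close> in \<open>P\<close>, then \<open>y i\<close> divides \<open>g * h\<close> with
  quotient \<open>f i / y i\<close> in \<open>S\<close>, so it divides \<open>g\<close>, say. This means that \<open>f i\<close> divides \<open>g\<close> in \<open>L' i\<close>,
  so \<open>h\<close> is invertible there, that is, \<open>h\<close> divides a monomial. As no variable divides \<open>h\<close>, it is a unit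
  of \<open>P\<close> (\<open>inverse_mem_P_if_inverse_mem_L'\<close>).
  
  All rings are subrings of one field, so divisibility of \<open>b\<close> by \<open>a\<close> in \<open>A\<close> is expressed as membership of
  the quotient \<open>b / a\<close> in \<open>A\<close>. This makes it easy to move between the many rings involved; only at the
  end are the notions translated to those of rings with a carrier set.
\<close>

section \<open>Primes and unique factorization in subrings of a field\<close>

locale field_subring =
  fixes A :: "'f::field set"
  assumes one_mem [simp]: "1 \<in> A"
    and uminus_mem: "a \<in> A \<Longrightarrow> - a \<in> A"
    and add_mem: "a \<in> A \<Longrightarrow> b \<in> A \<Longrightarrow> a + b \<in> A"
    and mult_mem: "a \<in> A \<Longrightarrow> b \<in> A \<Longrightarrow> a * b \<in> A"
begin

lemma zero_mem [simp]: "0 \<in> A"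
  using add_mem[OF one_mem uminus_mem[OF one_mem]] by simp

lemma diff_mem: "a \<in> A \<Longrightarrow> b \<in> A \<Longrightarrow> a - b \<in> A"
  using add_mem[of a "- b"] uminus_mem[of b] by simp

lemma power_mem: "a \<in> A \<Longrightarrow> a ^ e \<in> A"
  by (induction e) (auto intro: mult_mem)

lemma sum_mem: "(\<And>i. i \<in> I \<Longrightarrow> g i \<in> A) \<Longrightarrow> sum g I \<in> A"
  by (induction I rule: infinite_finite_induct) (auto intro: add_mem)

lemma prod_mem: "(\<And>i. i \<in> I \<Longrightarrow> g i \<in> A) \<Longrightarrow> prod g I \<in> A"
  by (induction I rule: infinite_finite_induct) (auto intro: mult_mem)

lemma prod_list_mem: "set as \<subseteq> A \<Longrightarrow> prod_list as \<in> A"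
  by (induction as) (auto intro: mult_mem)

end

definition unit_in :: "'f::field set \<Rightarrow> 'f \<Rightarrow> bool" where
  "unit_in A u \<longleftrightarrow> u \<noteq> 0 \<and> u \<in> A \<and> inverse u \<in> A"

definition prime_in :: "'f::field set \<Rightarrow> 'f \<Rightarrow> bool" where
  "prime_in A p \<longleftrightarrow> p \<noteq> 0 \<and> p \<in> A \<and> inverse p \<notin> A \<and>
     (\<forall>a\<in>A. \<forall>b\<in>A. a * b / p \<in> A \<longrightarrow> a / p \<in> A \<or> b / p \<in> A)"

text \<open>
  Existence of factorizations into primes is enough: uniqueness is automatic for prime factors.
\<close>

definition ufd :: "'f::field set \<Rightarrow> bool" where
  "ufd A \<longleftrightarrow> field_subring A \<and>
     (\<forall>a\<in>A. a \<noteq> 0 \<longrightarrow> (\<exists>u ps. unit_in A u \<and> (\<forall>p\<in>set ps. prime_in A p) \<and> a = u * prod_list ps))"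

lemma prime_inD:
  assumes "prime_in A p" shows "p \<noteq> 0" "p \<in> A" "inverse p \<notin> A"
  using assms by (auto simp: prime_in_def)

lemma prime_in_div: "prime_in A p \<Longrightarrow> a \<in> A \<Longrightarrow> b \<in> A \<Longrightarrow> a * b / p \<in> A \<Longrightarrow> a / p \<in> A \<or> b / p \<in> A"
  by (auto simp: prime_in_def)

lemma prod_list_primes_nonzero: "\<forall>p\<in>set ps. prime_in A p \<Longrightarrow> prod_list ps \<noteq> 0"
  by (auto simp: prod_list_zero_iff dest: prime_inD)

lemma ufd_subring: "ufd A \<Longrightarrow> field_subring A"
  by (simp add: ufd_def)

lemma ufd_factor:
  assumes "ufd A" "a \<in> A" "a \<noteq> 0"
  obtains u ps where "unit_in A u" "\<forall>p\<in>set ps. prime_in A p" "a = u * prod_list ps"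
  using assms by (auto simp: ufd_def)

lemma prod_list_remove1: "p \<in> set ps \<Longrightarrow> prod_list ps = p * prod_list (remove1 p (ps :: 'a::comm_monoid_mult list))"
  by (induction ps) (auto simp: ac_simps)

context field_subring begin

lemma unit_in_mult: "unit_in A u \<Longrightarrow> unit_in A v \<Longrightarrow> unit_in A (u * v)"
  by (auto simp: unit_in_def mult_mem)

lemma unit_in_inverse: "unit_in A u \<Longrightarrow> unit_in A (inverse u)"
  by (auto simp: unit_in_def)

lemma unit_in_one: "unit_in A 1"
  by (auto simp: unit_in_def)

lemma unit_in_divide: "unit_in A u \<Longrightarrow> a \<in> A \<Longrightarrow> a / u \<in> A"
  by (simp add: divide_inverse mult_mem unit_in_def)

text \<open>
  The factor \<open>u\<close> makes the induction on the list work; in the applications it is a unit.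
\<close>

lemma prime_in_div_prod_list:
  assumes p: "prime_in A p" and "u \<in> A" "set qs \<subseteq> A" "u * prod_list qs / p \<in> A"
  shows "u / p \<in> A \<or> (\<exists>q\<in>set qs. q / p \<in> A)"
  using assms(2-)
proof (induction qs arbitrary: u)
  case (Cons q qs)
  have "u * q / p \<in> A \<or> (\<exists>q\<in>set qs. q / p \<in> A)"
    using Cons.IH[of "u * q"] Cons.prems by (auto simp: mult_mem mult.assoc)
  thus ?case
    using prime_in_div[OF p, of u q] Cons.prems by auto
qed auto

lemma prime_in_not_div_unit: "prime_in A p \<Longrightarrow> unit_in A u \<Longrightarrow> u / p \<notin> A"
  using mult_mem[of "u / p" "inverse u"] by (auto simp: unit_in_def prime_in_def field_simps)

lemma prime_in_div_power:
  assumes "prime_in A p" "a \<in> A" "a ^ e / p \<in> A" shows "a / p \<in> A"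
  using assms(3)
proof (induction e)
  case 0 thus ?case using prime_inD[OF assms(1)] by (simp add: divide_inverse)
next
  case (Suc e) thus ?case using prime_in_div[OF assms(1,2), of "a ^ e"] assms(2) by (auto simp: power_mem)
qed

lemma prime_in_unit_mult:
  assumes p: "prime_in A p" and u: "unit_in A u" shows "prime_in A (u * p)"
proof -
  have [simp]: "u \<noteq> 0" "p \<noteq> 0" and uA: "u \<in> A" "inverse u \<in> A" using assms by (auto simp: unit_in_def prime_in_def)
  have *: "a / (u * p) \<in> A \<longleftrightarrow> a / p \<in> A" for a
    using mult_mem[OF uA(1), of "a / (u * p)"] mult_mem[OF uA(2), of "a / p"] by (auto simp: field_simps)
  show ?thesis
    using p *[of 1] uA * by (auto simp: prime_in_def divide_inverse mult_mem)
qed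

lemma prime_in_associated:
  assumes p: "prime_in A p" and q: "prime_in A q" and qp: "q / p \<in> A" shows "unit_in A (q / p)"
proof -
  have nz: "p \<noteq> 0" "q \<noteq> 0" using p q by (auto dest: prime_inD)
  have "p * (q / p) / q \<in> A" using nz by simp
  hence "p / q \<in> A \<or> (q / p) / q \<in> A"
    using prime_in_div[OF q _ qp] prime_inD(2)[OF p] by blast
  moreover have "(q / p) / q = inverse p" using nz by (simp add: field_simps)
  ultimately have "p / q \<in> A" using prime_inD(3)[OF p] by auto
  thus ?thesis using nz qp by (auto simp: unit_in_def)
qed

text \<open>
  Each prime \<open>q\<close> of the divisor is associated to one of the \<open>ps\<close>; cancelling the two changes the unit \<open>u\<close> only.
\<close>

lemma length_prime_divisors_le:
  assumes "unit_in A u" "\<forall>p\<in>set ps. prime_in A p" "\<forall>q\<in>set qs. prime_in A q"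
    "u * prod_list ps / prod_list qs \<in> A"
  shows "length qs \<le> length ps"
  using assms
proof (induction qs arbitrary: u ps)
  case (Cons q qs)
  have q: "prime_in A q" and nz: "q \<noteq> 0" and nz': "prod_list qs \<noteq> 0"
    using Cons.prems(3) prime_inD prod_list_primes_nonzero[of qs A] by auto
  have mem: "set qs \<subseteq> A" "set ps \<subseteq> A" "u \<in> A"
    using Cons.prems by (auto dest: prime_inD simp: unit_in_def)
  have "u * prod_list ps / q = prod_list qs * (u * prod_list ps / prod_list (q # qs))"
    using nz nz' by (simp add: field_simps)
  hence "u * prod_list ps / q \<in> A"
    using mult_mem[OF prod_list_mem[OF mem(1)] Cons.prems(4)] by simp
  then obtain p where p: "p \<in> set ps" "p / q \<in> A"
    using prime_in_div_prod_list[OF q mem(3,2)] prime_in_not_div_unit[OF q Cons.prems(1)] by auto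
  have e: "unit_in A (p / q)" using prime_in_associated[OF q _ p(2)] Cons.prems(2) p(1) by auto
  have eq: "prod_list ps = p * prod_list (remove1 p ps)"
    using p(1) by (simp add: prod_list_remove1)
  have "length qs \<le> length (remove1 p ps)"
  proof (rule Cons.IH)
    show "unit_in A (u * (p / q))" using unit_in_mult[OF Cons.prems(1) e] .
    show "\<forall>p'\<in>set (remove1 p ps). prime_in A p'" using Cons.prems(2) set_remove1_subset by fast
    show "\<forall>q\<in>set qs. prime_in A q" using Cons.prems(3) by auto
    show "u * (p / q) * prod_list (remove1 p ps) / prod_list qs \<in> A"
      using Cons.prems(4) nz by (simp add: eq field_simps)
  qed
  moreover have "length (remove1 p ps) = length ps - 1" using p(1) by (simp add: length_remove1)
  ultimately show ?case using length_pos_if_in_set[OF p(1)] unfolding list.size by linarith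
qed auto

end


text \<open>
  This finiteness statement is how factoriality is fed into Nagata's theorem below, where prime
  factors from a given set have to be split off until none is left.
\<close>

lemma ufd_prime_divisors_bounded:
  assumes "ufd A" "a \<in> A" "a \<noteq> 0"
  obtains N where "\<And>qs. \<forall>q\<in>set qs. prime_in A q \<Longrightarrow> a / prod_list qs \<in> A \<Longrightarrow> length qs \<le> N"
proof -
  interpret field_subring A by (rule ufd_subring) fact
  obtain u ps where "unit_in A u" "\<forall>p\<in>set ps. prime_in A p" "a = u * prod_list ps"
    using ufd_factor[OF assms] .
  thus ?thesis using length_prime_divisors_le that by blast
qed

lemma ufd_irreducible_prime:
  assumes A: "ufd A" and f: "f \<in> A" "f \<noteq> 0" "inverse f \<notin> A"
    and irr: "\<And>g h. g \<in> A \<Longrightarrow> h \<in> A \<Longrightarrow> f = g * h \<Longrightarrow> inverse g \<in> A \<or> inverse h \<in> A"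
  shows "prime_in A f"
proof -
  interpret field_subring A by (rule ufd_subring) fact
  obtain u ps where u: "unit_in A u" and ps: "\<forall>p\<in>set ps. prime_in A p" and eq: "f = u * prod_list ps"
    using ufd_factor[OF A f(1,2)] .
  show ?thesis
  proof (cases ps)
    case Nil
    thus ?thesis using eq u f(3) by (auto simp: unit_in_def)
  next
    case (Cons p qs)
    have mem: "u \<in> A" "prod_list qs \<in> A"
      using u ps Cons by (auto simp: unit_in_def dest: prime_inD intro!: prod_list_mem)
    have p: "prime_in A p" using ps Cons by auto
    have "inverse (u * prod_list qs) \<in> A"
      using irr[of p "u * prod_list qs"] eq Cons mem prime_inD[OF p] by (auto simp: mult_mem)
    moreover have "u * prod_list qs \<noteq> 0"
      using u ps Cons prod_list_primes_nonzero[of qs A] by (auto simp: unit_in_def)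
    ultimately have "unit_in A (u * prod_list qs)"
      using mem by (simp add: unit_in_def mult_mem)
    from prime_in_unit_mult[OF p this] show ?thesis using eq Cons by (simp add: ac_simps)
  qed
qed

lemma prime_in_irreducible:
  assumes "field_subring A" and f: "prime_in A f" and "g \<in> A" "h \<in> A" "f = g * h"
  shows "inverse g \<in> A \<or> inverse h \<in> A"
proof -
  interpret field_subring A by fact
  have "g \<noteq> 0" "h \<noteq> 0" using prime_inD[OF f] assms by auto
  thus ?thesis
    using prime_in_div[OF f assms(3,4)] assms(5) prime_inD(1)[OF f] by (auto simp: field_simps)
qed

lemma divisor_of_prime_product:
  assumes A: "field_subring A" and "\<forall>q\<in>set qs. prime_in A q" "a \<in> A" "b \<in> A" "a * b = prod_list qs"
  obtains v rs where "unit_in A v" "set rs \<subseteq> set qs" "a = v * prod_list rs"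
proof -
  interpret field_subring A by fact
  have "\<exists>v rs. unit_in A v \<and> set rs \<subseteq> set qs \<and> a = v * prod_list rs"
    using assms(2-)
  proof (induction qs arbitrary: a b)
    case Nil
    hence "inverse a = b" by (auto intro: inverse_unique)
    thus ?case using Nil by (auto simp: unit_in_def intro!: exI[of _ a] exI[of _ "[]"])
  next
    case (Cons q qs)
    have q: "prime_in A q" and nz: "q \<noteq> 0" and qs: "set qs \<subseteq> A" using Cons.prems(1) by (auto dest: prime_inD)
    have "a * b / q \<in> A" using Cons.prems(4) nz prod_list_mem[OF qs] by simp
    then consider "a / q \<in> A" | "b / q \<in> A" using prime_in_div[OF q] Cons.prems by blast
    thus ?case
    proof cases
      case 1
      obtain v rs where "unit_in A v" "set rs \<subseteq> set qs" "a / q = v * prod_list rs"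
        using Cons.IH[of "a / q" b] Cons.prems 1 nz by (auto simp: field_simps)
      thus ?thesis using nz by (auto simp: field_simps intro!: exI[of _ v] exI[of _ "q # rs"])
    next
      case 2
      obtain v rs where "unit_in A v" "set rs \<subseteq> set qs" "a = v * prod_list rs"
        using Cons.IH[of a "b / q"] Cons.prems 2 nz by (auto simp: field_simps)
      thus ?thesis by auto
    qed
  qed
  thus ?thesis using that by blast
qed

section \<open>Nagata's theorem\<close>

text \<open>
  If \<open>c\<close> has a denominator made of primes in \<open>Q\<close> but \<open>a * c\<close> has none, then each of these primes would
  have to divide \<open>a\<close> unless the denominator cancels already.
\<close>

lemma cancel_denominators:
  assumes A: "field_subring A"
    and prm: "\<And>q. q \<in> Q \<Longrightarrow> prime_in A q"
    and red: "\<And>q. q \<in> Q \<Longrightarrow> a / q \<notin> A"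
    and a: "a \<in> A" "a * c \<in> A" and qs: "set qs \<subseteq> Q" "prod_list qs * c \<in> A"
  shows "c \<in> A"
  using qs
proof (induction qs)
  case (Cons q qs)
  interpret field_subring A by fact
  have q: "prime_in A q" "q \<noteq> 0" and qs: "set qs \<subseteq> A" using prm Cons.prems(1) by (auto dest: prime_inD)
  have "a * (q * (prod_list qs * c)) / q = prod_list qs * (a * c)" using q(2) by (simp add: field_simps)
  hence "a * (q * (prod_list qs * c)) / q \<in> A" using a(2) prod_list_mem[OF qs] by (simp add: mult_mem)
  hence "prod_list qs * c \<in> A"
    using prime_in_div[OF q(1) a(1), of "q * (prod_list qs * c)"] Cons.prems q(2) red
    by (auto simp: mult.assoc)
  thus ?case using Cons by auto
qed auto

text \<open>
  Here \<open>B\<close> is \<open>A\<close> with a set \<open>Q\<close> of primes of \<open>A\<close> inverted. A prime of \<open>B\<close> can be multiplied by a unit of \<open>B\<close>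
  so that it lies in \<open>A\<close> and is divisible by no element of \<open>Q\<close>. By \<open>cancel_denominators\<close>, divisibility
  by such a reduced element means the same in \<open>A\<close> and in \<open>B\<close>, so it is prime in \<open>A\<close>. A factorization in \<open>B\<close>
  therefore becomes one in \<open>A\<close>, up to a unit of \<open>B\<close> that lies in \<open>A\<close>; the latter is a product of
  elements of \<open>Q\<close> and a unit of \<open>A\<close>. The last hypothesis guarantees that reducing terminates.
\<close>

theorem nagata_ufd:
  assumes A: "field_subring A" and B: "ufd B" and AB: "A \<subseteq> B"
    and prm: "\<And>q. q \<in> Q \<Longrightarrow> prime_in A q"
    and inv: "\<And>q. q \<in> Q \<Longrightarrow> inverse q \<in> B"
    and den: "\<And>b. b \<in> B \<Longrightarrow> \<exists>qs. set qs \<subseteq> Q \<and> prod_list qs * b \<in> A"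
    and bnd: "\<And>a. a \<in> A \<Longrightarrow> a \<noteq> 0 \<Longrightarrow> \<exists>N. \<forall>qs. set qs \<subseteq> Q \<longrightarrow> a / prod_list qs \<in> A \<longrightarrow> length qs \<le> N"
  shows "ufd A"
proof -
  interpret A: field_subring A by fact
  interpret B: field_subring B by (rule ufd_subring) fact
  have nz: "prod_list qs \<noteq> 0" if "set qs \<subseteq> Q" for qs
    using that prm by (intro prod_list_primes_nonzero[of qs A]) auto
  have unitQ: "unit_in B (prod_list qs)" if "set qs \<subseteq> Q" for qs
    using that
  proof (induction qs)
    case (Cons q qs)
    have "unit_in B q" using Cons.prems inv prm AB by (auto simp: unit_in_def dest: prime_inD)
    thus ?case using Cons B.unit_in_mult by auto
  qed (auto intro: B.unit_in_one)
  define reduced where "reduced a \<longleftrightarrow> a \<in> A \<and> a \<noteq> 0 \<and> (\<forall>q\<in>Q. a / q \<notin> A)" for a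
  have strip: "\<exists>qs a0. set qs \<subseteq> Q \<and> reduced a0 \<and> a = prod_list qs * a0" if a: "a \<in> A" "a \<noteq> 0" for a
  proof -
    obtain N where N: "\<And>qs. set qs \<subseteq> Q \<Longrightarrow> a / prod_list qs \<in> A \<Longrightarrow> length qs \<le> N" using bnd[OF a] by blast
    \<comment> \<open>A divisor of maximal length leaves a quotient that no element of \<open>Q\<close> divides.\<close>
    define P where "P k \<longleftrightarrow> (\<exists>qs. length qs = k \<and> set qs \<subseteq> Q \<and> a / prod_list qs \<in> A)" for k
    have "P 0" using a by (auto simp: P_def)
    moreover have "k \<le> N" if "P k" for k using that N by (auto simp: P_def)
    ultimately have "P (Greatest P)" and max: "\<And>k. P k \<Longrightarrow> k \<le> Greatest P"
      using GreatestI_nat[of P 0 N] Greatest_le_nat[of P _ N] by auto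
    then obtain qs where qs: "length qs = Greatest P" "set qs \<subseteq> Q" "a / prod_list qs \<in> A"
      using \<open>P (Greatest P)\<close> unfolding P_def by blast
    have "a / prod_list qs / q \<notin> A" if "q \<in> Q" for q
    proof
      assume "a / prod_list qs / q \<in> A"
      hence "P (length (q # qs))"
        unfolding P_def using that qs(2) by (intro exI[of _ "q # qs"]) (auto simp: mult.commute)
      from max[OF this] show False using qs(1) by simp
    qed
    thus ?thesis using qs nz[OF qs(2)] a
      by (intro exI[of _ qs] exI[of _ "a / prod_list qs"]) (auto simp: reduced_def)
  qed
  have cancel: "c \<in> A" if "reduced a" "a * c \<in> A" "c \<in> B" for a c
    using den[OF that(3)] cancel_denominators[OF A prm] that(1,2) unfolding reduced_def by metis
  have norm: "\<exists>u p0. unit_in B u \<and> reduced p0 \<and> prime_in A p0 \<and> p = u * p0" if p: "prime_in B p" for p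
  proof -
    obtain qs where qs: "set qs \<subseteq> Q" "prod_list qs * p \<in> A" using den prime_inD[OF p] by blast
    obtain rs p0 where rs: "set rs \<subseteq> Q" "reduced p0" "prod_list qs * p = prod_list rs * p0"
      using strip[OF qs(2)] nz[OF qs(1)] prime_inD[OF p] by auto
    define u where "u = prod_list rs * inverse (prod_list qs)"
    have u: "unit_in B u" unfolding u_def
      using B.unit_in_mult[OF unitQ[OF rs(1)] B.unit_in_inverse[OF unitQ[OF qs(1)]]] .
    have p0: "p0 = inverse u * p" "p = u * p0"
      using rs(3) nz[OF qs(1)] nz[OF rs(1)] by (auto simp: u_def field_simps)
    have pB: "prime_in B p0"
      using B.prime_in_unit_mult[OF p B.unit_in_inverse[OF u]] p0(1) by simp
    have "prime_in A p0"
      unfolding prime_in_def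
    proof (intro conjI ballI impI)
      show "p0 \<noteq> 0" "p0 \<in> A" using rs(2) by (auto simp: reduced_def)
      show "inverse p0 \<notin> A" using prime_inD[OF pB] AB by auto
      fix a b assume ab: "a \<in> A" "b \<in> A" "a * b / p0 \<in> A"
      have "c / p0 \<in> A" if "c \<in> A" "c / p0 \<in> B" for c
        using cancel[OF rs(2), of "c / p0"] that rs(2) by (auto simp: reduced_def)
      thus "a / p0 \<in> A \<or> b / p0 \<in> A"
        using prime_in_div[OF pB, of a b] ab AB by blast
    qed
    thus ?thesis using u rs(2) p0(2) by blast
  qed
  have norm_list: "\<exists>u rs. unit_in B u \<and> (\<forall>p\<in>set rs. reduced p \<and> prime_in A p) \<and> prod_list ps = u * prod_list rs"
    if "\<forall>p\<in>set ps. prime_in B p" for ps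
    using that
  proof (induction ps)
    case Nil
    show ?case by (intro exI[of _ 1] exI[of _ "[]"]) (auto simp: B.unit_in_one)
  next
    case (Cons p ps)
    obtain u rs where *: "unit_in B u" "\<forall>p\<in>set rs. reduced p \<and> prime_in A p" "prod_list ps = u * prod_list rs"
      using Cons by auto
    obtain v p0 where "unit_in B v" "reduced p0" "prime_in A p0" "p = v * p0"
      using norm[of p] Cons.prems by auto
    thus ?case using * B.unit_in_mult
      by (intro exI[of _ "v * u"] exI[of _ "p0 # rs"]) (auto simp: ac_simps)
  qed
  have cancel_list: "c \<in> A" if "\<forall>p\<in>set rs. reduced p" "c \<in> B" "prod_list rs * c \<in> A" for rs c
    using that
  proof (induction rs)
    case (Cons r rs)
    have "prod_list rs * c \<in> B"
      using Cons.prems AB by (intro B.mult_mem B.prod_list_mem) (auto simp: reduced_def)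
    thus ?case using Cons cancel[of r "prod_list rs * c"] by (auto simp: mult.assoc)
  qed auto
  show ?thesis unfolding ufd_def
  proof (intro conjI ballI impI A)
    fix a assume a: "a \<in> A" "a \<noteq> 0"
    obtain u ps where ups: "unit_in B u" "\<forall>p\<in>set ps. prime_in B p" "a = u * prod_list ps"
      using ufd_factor[OF B _ a(2)] a(1) AB by auto
    obtain v rs where vrs: "unit_in B v" "\<forall>p\<in>set rs. reduced p \<and> prime_in A p" "prod_list ps = v * prod_list rs"
      using norm_list[OF ups(2)] by auto
    \<comment> \<open>Only the unit \<open>w\<close> of \<open>B\<close> remains; its reduced part is a unit of \<open>A\<close>.\<close>
    define w where "w = u * v"
    have w: "unit_in B w" "a = prod_list rs * w" using ups vrs by (auto simp: w_def B.unit_in_mult ac_simps)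
    have "w \<in> A" using cancel_list[of rs w] vrs w a by (auto simp: unit_in_def)
    then obtain qs w0 where qs: "set qs \<subseteq> Q" "reduced w0" "w = prod_list qs * w0"
      using strip[of w] w(1) by (auto simp: unit_in_def)
    have "inverse w0 = prod_list qs * inverse w"
      using qs nz[OF qs(1)] by (auto simp: reduced_def field_simps)
    hence "inverse w0 \<in> B" using w(1) unitQ[OF qs(1)] by (auto simp: unit_in_def B.mult_mem)
    hence "unit_in A w0" using cancel[OF qs(2), of "inverse w0"] qs(2) by (auto simp: unit_in_def reduced_def)
    thus "\<exists>u ps. unit_in A u \<and> (\<forall>p\<in>set ps. prime_in A p) \<and> a = u * prod_list ps"
      using vrs qs prm w(2) by (intro exI[of _ w0] exI[of _ "qs @ rs"]) (auto simp: ac_simps)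
  qed
qed

section \<open>Localization at one element\<close>

text \<open>
  Inverting a single element suffices for Laurent rings: invert the product of all variables.
\<close>

definition localization :: "'f::field set \<Rightarrow> 'f \<Rightarrow> 'f set" where
  "localization A q = {a. \<exists>e. a * q ^ e \<in> A}"

lemma subset_localization: "A \<subseteq> localization A q"
  by (auto simp: localization_def intro: exI[of _ 0])

lemma inverse_mem_localization:
  assumes "field_subring A" "q \<noteq> 0" shows "inverse q \<in> localization A q"
  using assms by (auto simp: localization_def field_subring.one_mem intro!: exI[of _ 1])

lemma localization_subring:
  assumes "field_subring A" "q \<in> A" shows "field_subring (localization A q)"
proof -
  interpret field_subring A by fact
  show ?thesis
  proof
    show "1 \<in> localization A q" using subset_localization[of A q] by auto
    fix a assume "a \<in> localization A q"
    then obtain e where e: "a * q ^ e \<in> A" by (auto simp: localization_def)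
    show "- a \<in> localization A q" using uminus_mem[OF e] by (auto simp: localization_def)
    fix b assume "b \<in> localization A q"
    then obtain e' where e': "b * q ^ e' \<in> A" by (auto simp: localization_def)
    have "(a + b) * q ^ (e + e') = a * q ^ e * q ^ e' + b * q ^ e' * q ^ e" by (simp add: power_add algebra_simps)
    also have "\<dots> \<in> A"
      using add_mem[OF mult_mem[OF e power_mem] mult_mem[OF e' power_mem]] assms(2) by blast
    finally show "a + b \<in> localization A q" by (auto simp: localization_def)
    have "(a * b) * q ^ (e + e') = (a * q ^ e) * (b * q ^ e')" by (simp add: power_add algebra_simps)
    also have "\<dots> \<in> A" by (rule mult_mem[OF e e'])
    finally show "a * b \<in> localization A q" by (auto simp: localization_def)
  qed
qed

lemma prime_in_localization:
  assumes "field_subring A" and q: "q \<in> A" "q \<noteq> 0" and p: "prime_in A p" and npq: "q / p \<notin> A"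
  shows "prime_in (localization A q) p"
proof -
  interpret field_subring A by fact
  have cl: "c / p \<in> localization A q" if "c * q ^ e / p \<in> A" for c e
    using that by (auto simp: localization_def field_simps intro!: exI[of _ e])
  have nq: "q ^ e / p \<notin> A" for e using npq prime_in_div_power[OF p q(1)] by blast
  show ?thesis
    unfolding prime_in_def
  proof (intro conjI ballI impI)
    show "p \<noteq> 0" "p \<in> localization A q" using prime_inD[OF p] subset_localization by auto
    show "inverse p \<notin> localization A q" using nq by (auto simp: localization_def field_simps)
    fix a b assume "a \<in> localization A q" "b \<in> localization A q" "a * b / p \<in> localization A q"
    then obtain e1 e2 e3 where e: "a * q ^ e1 \<in> A" "b * q ^ e2 \<in> A" "a * b / p * q ^ e3 \<in> A"
      by (auto simp: localization_def)
    have "((a * q ^ e1) * (b * q ^ e2)) * q ^ e3 / p = (a * b / p * q ^ e3) * (q ^ e1 * q ^ e2)"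
      by (simp add: field_simps)
    also have "\<dots> \<in> A" using mult_mem[OF e(3) mult_mem[OF power_mem power_mem]] q(1) by blast
    finally have "((a * q ^ e1) * (b * q ^ e2)) / p \<in> A"
      using prime_in_div[OF p _ power_mem[OF q(1)]] nq e by (meson mult_mem)
    hence "a * q ^ e1 / p \<in> A \<or> b * q ^ e2 / p \<in> A" using prime_in_div[OF p] e by blast
    thus "a / p \<in> localization A q \<or> b / p \<in> localization A q" using cl by blast
  qed
qed

text \<open>
  A prime of \<open>A\<close> stays prime or, if it divides \<open>q\<close>, becomes a unit.
\<close>

lemma ufd_localization:
  assumes A: "ufd A" and q: "q \<in> A" "q \<noteq> 0"
  shows "ufd (localization A q)"
proof -
  interpret field_subring A by (rule ufd_subring) fact
  interpret B: field_subring "localization A q" by (rule localization_subring) (fact field_subring_axioms q)+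
  have unit: "unit_in (localization A q) v" if "unit_in A v" for v
    using that subset_localization[of A q] by (auto simp: unit_in_def)
  have prime: "unit_in (localization A q) p \<or> prime_in (localization A q) p" if p: "prime_in A p" for p
  proof (cases "q / p \<in> A")
    case True
    hence "inverse p * q ^ 1 \<in> A" by (simp add: field_simps)
    hence "inverse p \<in> localization A q" unfolding localization_def by blast
    thus ?thesis using prime_inD[OF p] subset_localization[of A q] by (auto simp: unit_in_def)
  qed (use prime_in_localization[OF field_subring_axioms q p] in auto)
  have fac: "\<exists>u ps. unit_in (localization A q) u \<and> (\<forall>p\<in>set ps. prime_in (localization A q) p) \<and> prod_list rs = u * prod_list ps"
    if "\<forall>p\<in>set rs. prime_in A p" for rs
    using that
  proof (induction rs)
    case Nil show ?case by (intro exI[of _ 1] exI[of _ "[]"]) (auto simp: B.unit_in_one)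
  next
    case (Cons r rs)
    obtain u ps where *: "unit_in (localization A q) u" "\<forall>p\<in>set ps. prime_in (localization A q) p"
      "prod_list rs = u * prod_list ps" using Cons by auto
    show ?case
    proof (cases "unit_in (localization A q) r")
      case True
      thus ?thesis using * B.unit_in_mult[OF True *(1)] by (intro exI[of _ "r * u"] exI[of _ ps]) auto
    next
      case False
      thus ?thesis using * prime[of r] Cons.prems by (intro exI[of _ u] exI[of _ "r # ps"]) (auto simp: ac_simps)
    qed
  qed
  show ?thesis unfolding ufd_def
  proof (intro conjI ballI impI B.field_subring_axioms)
    fix a assume a: "a \<in> localization A q" "a \<noteq> 0"
    then obtain e where e: "a * q ^ e \<in> A" by (auto simp: localization_def)
    obtain v rs where v: "unit_in A v" "\<forall>p\<in>set rs. prime_in A p" "a * q ^ e = v * prod_list rs"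
      using ufd_factor[OF A e] a q by auto
    obtain u ps where *: "unit_in (localization A q) u" "\<forall>p\<in>set ps. prime_in (localization A q) p"
      "prod_list rs = u * prod_list ps" using fac[OF v(2)] by auto
    have "unit_in (localization A q) (inverse q ^ e)"
      using q subset_localization[of A q] inverse_mem_localization[OF field_subring_axioms q(2)] B.power_mem[of "inverse q" e]
      by (auto simp: unit_in_def B.power_mem power_inverse)
    moreover have "a = (inverse q ^ e * (v * u)) * prod_list ps"
      using v(3) *(3) q by (simp add: field_simps)
    ultimately show "\<exists>u ps. unit_in (localization A q) u \<and> (\<forall>p\<in>set ps. prime_in (localization A q) p) \<and> a = u * prod_list ps"
      using *(2) B.unit_in_mult[OF _ B.unit_in_mult[OF unit[OF v(1)] *(1)]] by blast
  qed
qed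

section \<open>Adjoining a transcendental element: Gauss' lemma\<close>

text \<open>
  Polynomials over \<open>A\<close> are polynomials over the ambient field with coefficients in \<open>A\<close>. For transcendental
  \<open>x\<close> they are determined by their values at \<open>x\<close>, so \<open>adjoin A x\<close> is a polynomial ring that is again a
  subset of the ambient field, and the construction can be iterated.
\<close>

definition polys_over :: "'f::field set \<Rightarrow> 'f poly set" where
  "polys_over A = {p. \<forall>i. coeff p i \<in> A}"

definition adjoin :: "'f::field set \<Rightarrow> 'f \<Rightarrow> 'f set" where
  "adjoin A x = (\<lambda>p. poly p x) ` polys_over A"

definition transcendental_over :: "'f::field set \<Rightarrow> 'f \<Rightarrow> bool" where
  "transcendental_over A x \<longleftrightarrow> (\<forall>p\<in>polys_over A. poly p x = 0 \<longrightarrow> p = 0)"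

lemma polys_overD: "p \<in> polys_over A \<Longrightarrow> coeff p i \<in> A"
  by (simp add: polys_over_def)

lemma adjoinI: "p \<in> polys_over A \<Longrightarrow> poly p x = a \<Longrightarrow> a \<in> adjoin A x"
  by (auto simp: adjoin_def)

context field_subring begin

lemma polys_over_monom: "a \<in> A \<Longrightarrow> monom a i \<in> polys_over A"
  by (auto simp: polys_over_def)

lemma polys_over_0: "0 \<in> polys_over A"
  by (auto simp: polys_over_def)

lemma polys_over_pCons: "a \<in> A \<Longrightarrow> p \<in> polys_over A \<Longrightarrow> pCons a p \<in> polys_over A"
  by (auto simp: polys_over_def coeff_pCons split: nat.splits)

lemma polys_over_const: "a \<in> A \<Longrightarrow> [:a:] \<in> polys_over A"
  by (intro polys_over_pCons polys_over_0)

lemma polys_over_1: "1 \<in> polys_over A"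
  using polys_over_const[OF one_mem] by (simp add: one_pCons)

lemma polys_over_add: "p \<in> polys_over A \<Longrightarrow> q \<in> polys_over A \<Longrightarrow> p + q \<in> polys_over A"
  by (auto simp: polys_over_def add_mem)

lemma polys_over_diff: "p \<in> polys_over A \<Longrightarrow> q \<in> polys_over A \<Longrightarrow> p - q \<in> polys_over A"
  by (auto simp: polys_over_def diff_mem)

lemma polys_over_uminus: "p \<in> polys_over A \<Longrightarrow> - p \<in> polys_over A"
  by (auto simp: polys_over_def uminus_mem)

lemma polys_over_smult: "a \<in> A \<Longrightarrow> p \<in> polys_over A \<Longrightarrow> smult a p \<in> polys_over A"
  by (auto simp: polys_over_def mult_mem)

lemma polys_over_mult: "p \<in> polys_over A \<Longrightarrow> q \<in> polys_over A \<Longrightarrow> p * q \<in> polys_over A"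
  by (auto simp: polys_over_def coeff_mult intro!: sum_mem mult_mem)

lemma adjoin_subring: "field_subring (adjoin A x)"
proof
  show "1 \<in> adjoin A x" using polys_over_1 by (rule adjoinI) simp
  fix a assume "a \<in> adjoin A x"
  then obtain p where p: "p \<in> polys_over A" "a = poly p x" by (auto simp: adjoin_def)
  show "- a \<in> adjoin A x" using polys_over_uminus[OF p(1)] by (rule adjoinI) (simp add: p)
  fix b assume "b \<in> adjoin A x"
  then obtain q where q: "q \<in> polys_over A" "b = poly q x" by (auto simp: adjoin_def)
  show "a + b \<in> adjoin A x" using polys_over_add[OF p(1) q(1)] by (rule adjoinI) (simp add: p q)
  show "a * b \<in> adjoin A x" using polys_over_mult[OF p(1) q(1)] by (rule adjoinI) (simp add: p q)
qed

lemma subset_adjoin: "A \<subseteq> adjoin A x"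
  using polys_over_const by (auto intro!: adjoinI)

lemma mem_adjoin: "x \<in> adjoin A x"
  using polys_over_pCons[OF zero_mem polys_over_1] by (rule adjoinI) simp

lemma transcendental_over_eqD:
  assumes "transcendental_over A x" "p \<in> polys_over A" "q \<in> polys_over A" "poly p x = poly q x"
  shows "p = q"
  using assms polys_over_diff[of p q] by (auto simp: transcendental_over_def)

lemma transcendental_over_nonzero: "transcendental_over A x \<Longrightarrow> x \<noteq> 0"
  using polys_over_pCons[OF zero_mem polys_over_1] by (force simp: transcendental_over_def)

text \<open>
  If \<open>a / c\<close> is the value at \<open>x\<close> of a polynomial \<open>q\<close>, then \<open>c * q = a\<close> holds for polynomials; compare the constant coefficients.
\<close>

lemma adjoin_divide_constant:
  assumes x: "transcendental_over A x" and "a \<in> A" "c \<in> A" "c \<noteq> 0" "a / c \<in> adjoin A x"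
  shows "a / c \<in> A"
proof -
  obtain q where q: "q \<in> polys_over A" "a / c = poly q x" using assms by (auto simp: adjoin_def)
  have "smult c q = [:a:]"
    using q assms by (intro transcendental_over_eqD[OF x] polys_over_smult polys_over_const) (auto simp: field_simps)
  hence "c * coeff q 0 = a" by (metis coeff_pCons_0 coeff_smult)
  thus ?thesis using polys_overD[OF q(1), of 0] assms by (auto simp: field_simps)
qed

lemma prime_in_of_prime_in_adjoin:
  assumes x: "transcendental_over A x" and c: "c \<in> A" "prime_in (adjoin A x) c"
  shows "prime_in A c"
proof -
  have nz: "c \<noteq> 0" using prime_inD[OF c(2)] by auto
  have eq: "a / c \<in> adjoin A x \<longleftrightarrow> a / c \<in> A" if "a \<in> A" for a
    using adjoin_divide_constant[OF x that c(1) nz] subset_adjoin by blast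
  show ?thesis
    unfolding prime_in_def
  proof (intro conjI ballI impI nz c(1))
    show "inverse c \<notin> A" using prime_inD[OF c(2)] subset_adjoin by blast
    fix a b assume "a \<in> A" "b \<in> A" "a * b / c \<in> A"
    thus "a / c \<in> A \<or> b / c \<in> A"
      using prime_in_div[OF c(2), of a b] eq subset_adjoin by blast
  qed
qed

text \<open>
  Gauss' argument: if \<open>p\<close> divides neither factor, take in each the first coefficient that \<open>p\<close> does not divide;
  modulo \<open>p\<close>, their product is the coefficient of the product in the corresponding degree.
\<close>

lemma prime_in_adjoin:
  assumes x: "transcendental_over A x" and p: "prime_in A p"
  shows "prime_in (adjoin A x) p"
  unfolding prime_in_def
proof (intro conjI ballI impI)
  show nz: "p \<noteq> 0" "p \<in> adjoin A x" using prime_inD[OF p] subset_adjoin by auto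
  show "inverse p \<notin> adjoin A x"
    using adjoin_divide_constant[OF x one_mem, of p] prime_inD[OF p] by (auto simp: divide_inverse)
  fix a b assume "a \<in> adjoin A x" "b \<in> adjoin A x" "a * b / p \<in> adjoin A x"
  then obtain f g h where fgh: "f \<in> polys_over A" "g \<in> polys_over A" "h \<in> polys_over A"
    "a = poly f x" "b = poly g x" "a * b / p = poly h x" by (auto simp: adjoin_def)
  have eq: "f * g = smult p h"
    using fgh prime_inD[OF p] nz
    by (intro transcendental_over_eqD[OF x] polys_over_mult polys_over_smult) (auto simp: field_simps)
  have div: "poly q x / p \<in> adjoin A x" if "\<And>i. coeff q i / p \<in> A" for q
    using that by (intro adjoinI[of "smult (inverse p) q"]) (auto simp: polys_over_def field_simps)
  show "a / p \<in> adjoin A x \<or> b / p \<in> adjoin A x"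
  proof (rule ccontr)
    assume "\<not> (a / p \<in> adjoin A x \<or> b / p \<in> adjoin A x)"
    hence ex: "\<exists>i. coeff f i / p \<notin> A" "\<exists>j. coeff g j / p \<notin> A" using div fgh by blast+
    define i where "i = (LEAST i. coeff f i / p \<notin> A)"
    define j where "j = (LEAST j. coeff g j / p \<notin> A)"
    have i: "coeff f i / p \<notin> A" "\<And>k. k < i \<Longrightarrow> coeff f k / p \<in> A"
      using LeastI_ex[OF ex(1)] not_less_Least unfolding i_def by blast+
    have j: "coeff g j / p \<notin> A" "\<And>k. k < j \<Longrightarrow> coeff g k / p \<in> A"
      using LeastI_ex[OF ex(2)] not_less_Least unfolding j_def by blast+
    have "coeff f k * coeff g (i + j - k) / p \<in> A" if "k \<in> {..i+j} - {i}" for k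
    proof (cases "k < i")
      case True
      thus ?thesis using mult_mem[OF i(2) polys_overD[OF fgh(2)], of k "i + j - k"] by simp
    next
      case False
      hence "i + j - k < j" using that by auto
      thus ?thesis using mult_mem[OF polys_overD[OF fgh(1)] j(2), of "i + j - k" k] by simp
    qed
    hence rest: "(\<Sum>k\<in>{..i+j} - {i}. coeff f k * coeff g (i + j - k) / p) \<in> A" (is "?S \<in> A") by (rule sum_mem)
    have "coeff (f * g) (i + j) / p = (\<Sum>k\<le>i+j. coeff f k * coeff g (i + j - k) / p)"
      by (simp add: coeff_mult sum_divide_distrib)
    also have "\<dots> = coeff f i * coeff g j / p + ?S"
      by (subst sum.remove[of _ i]) auto
    finally have "coeff f i * coeff g j / p = coeff h (i + j) - ?S"
      using prime_inD[OF p] by (simp add: eq)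
    hence "coeff f i * coeff g j / p \<in> A"
      using diff_mem[OF polys_overD[OF fgh(3)] rest] by simp
    thus False using prime_in_div[OF p polys_overD[OF fgh(1)] polys_overD[OF fgh(2)]] i j by blast
  qed
qed

lemma prime_in_adjoin_variable:
  assumes x: "transcendental_over A x"
  shows "prime_in (adjoin A x) x"
  unfolding prime_in_def
proof (intro conjI ballI impI)
  show nz: "x \<noteq> 0" by (rule transcendental_over_nonzero[OF x])
  show "x \<in> adjoin A x" by (rule mem_adjoin)
  have quot: "coeff f 0 = 0" if f: "f \<in> polys_over A" and fx: "poly f x / x \<in> adjoin A x" for f
  proof -
    obtain q where q: "q \<in> polys_over A" "poly f x / x = poly q x" using fx by (auto simp: adjoin_def)
    have "f = pCons 0 q"
      using nz q f by (intro transcendental_over_eqD[OF x] polys_over_pCons) (auto simp: field_simps)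
    thus ?thesis by simp
  qed
  show "inverse x \<notin> adjoin A x"
    using quot[OF polys_over_1] by (auto simp: divide_inverse)
  fix a b assume "a \<in> adjoin A x" "b \<in> adjoin A x" and ab: "a * b / x \<in> adjoin A x"
  then obtain f g where fg: "f \<in> polys_over A" "g \<in> polys_over A" "a = poly f x" "b = poly g x"
    by (auto simp: adjoin_def)
  have div: "poly q x / x \<in> adjoin A x" if q: "q \<in> polys_over A" "coeff q 0 = 0" for q
  proof (cases q)
    case (pCons c r)
    thus ?thesis using q nz polys_overD[OF q(1), of "Suc _"]
      by (intro adjoinI[of r]) (auto simp: polys_over_def)
  qed
  have "coeff (f * g) 0 = 0" using quot[OF polys_over_mult[OF fg(1,2)]] ab fg by simp
  hence "coeff f 0 = 0 \<or> coeff g 0 = 0" by (simp add: coeff_mult)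
  thus "a / x \<in> adjoin A x \<or> b / x \<in> adjoin A x" using div fg by blast
qed

text \<open>
  This is why a mutated cluster generates a polynomial ring. An equation \<open>p (f / x) = 0\<close> turns into one
  for \<open>x\<close> by scaling the coefficients of \<open>p\<close> with powers of \<open>f\<close> and reversing their order.
\<close>

lemma transcendental_over_exchange:
  assumes x: "transcendental_over A x" and f: "f \<in> A" "f \<noteq> 0"
  shows "transcendental_over A (f / x)"
  unfolding transcendental_over_def
proof (intro ballI impI)
  fix p assume p: "p \<in> polys_over A" "poly p (f / x) = 0"
  have nz: "x \<noteq> 0" by (rule transcendental_over_nonzero[OF x])
  define q where "q = reflect_poly (pcompose p [:0, f:])"
  have "q \<in> polys_over A"
    using p f by (auto simp: polys_over_def q_def coeff_reflect_poly coeff_pcompose_linear intro!: mult_mem power_mem)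
  moreover have "poly q x = 0"
    using p(2) nz by (simp add: q_def poly_reflect_poly_nz poly_pcompose divide_inverse mult.commute)
  ultimately have "q = 0" using x by (simp add: transcendental_over_def)
  hence "pcompose p [:0, f:] = 0" by (simp add: q_def)
  hence "f ^ i * coeff p i = 0" for i by (metis coeff_0 coeff_pcompose_linear)
  thus "p = 0" using f(2) by (simp add: poly_eq_iff)
qed

end

locale subfield_of_field = field_subring K for K :: "'f::field set" +
  assumes inverse_mem: "a \<in> K \<Longrightarrow> inverse a \<in> K"
begin

lemma division_with_remainder:
  assumes "p \<in> polys_over K" "q \<in> polys_over K" "q \<noteq> 0"
  shows "\<exists>s\<in>polys_over K. \<exists>r\<in>polys_over K. p = s * q + r \<and> (r = 0 \<or> degree r < degree q)"
  using assms(1)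
proof (induction "degree p" arbitrary: p rule: less_induct)
  case less
  show ?case
  proof (cases "p = 0 \<or> degree p < degree q")
    case True
    thus ?thesis using less.prems polys_over_0 by (intro bexI[of _ 0] bexI[of _ p]) auto
  next
    case False
    define t where "t = monom (lead_coeff p * inverse (lead_coeff q)) (degree p - degree q)"
    have t: "t \<in> polys_over K" unfolding t_def
      using polys_overD[OF less.prems] inverse_mem[OF polys_overD[OF assms(2)]]
      by (intro polys_over_monom mult_mem)
    hence p': "p - t * q \<in> polys_over K" using less.prems assms polys_over_diff polys_over_mult by blast
    have "degree (t * q) \<le> degree p"
      using False degree_mult_le[of t q] degree_monom_le[of "lead_coeff p * inverse (lead_coeff q)" "degree p - degree q"]
      unfolding t_def by linarith
    hence "degree (p - t * q) \<le> degree p" by (intro degree_diff_le) auto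
    moreover have "coeff (p - t * q) (degree p) = 0"
      using False assms(3) by (simp add: t_def coeff_monom_mult)
    ultimately consider "p - t * q = 0" | "degree (p - t * q) < degree p"
      using eq_zero_or_degree_less by blast
    then obtain s r where sr: "s \<in> polys_over K" "r \<in> polys_over K" "p - t * q = s * q + r" "r = 0 \<or> degree r < degree q"
    proof cases
      case 1 thus ?thesis using that[of 0 0] polys_over_0 by auto
    next
      case 2 thus ?thesis using less.hyps[OF 2 p'] that by blast
    qed
    have "p = (s + t) * q + r" using sr(3) by (simp add: algebra_simps)
    thus ?thesis using sr t polys_over_add by blast
  qed
qed

text \<open>
  Euclid's lemma. A nonzero combination \<open>r\<close> of \<open>p\<close> and \<open>g\<close> of least degree divides both. As \<open>p\<close> is
  irreducible, \<open>r\<close> is constant, and then \<open>p\<close> divides \<open>r * h\<close> and \<open>h\<close>; or it is associated to \<open>p\<close>, and then \<open>p\<close> divides \<open>g\<close>.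
\<close>

lemma irreducible_poly_divides:
  assumes p: "p \<in> polys_over K" "degree p > 0"
    and irr: "\<And>g h. g \<in> polys_over K \<Longrightarrow> h \<in> polys_over K \<Longrightarrow> p = g * h \<Longrightarrow> degree g = 0 \<or> degree h = 0"
    and gh: "g \<in> polys_over K" "h \<in> polys_over K" "c \<in> polys_over K" "g * h = p * c"
  shows "\<exists>k\<in>polys_over K. g = p * k \<or> h = p * k"
proof -
  define J where "J r \<longleftrightarrow> r \<noteq> 0 \<and> (\<exists>u\<in>polys_over K. \<exists>v\<in>polys_over K. r = u * p + v * g)" for r
  have "p = 1 * p + 0 * g" by simp
  hence "J p" using p polys_over_0 polys_over_1 unfolding J_def by fastforce
  then obtain r where r: "J r" "\<And>r'. J r' \<Longrightarrow> degree r \<le> degree r'"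
    using ex_has_least_nat[of J p degree] by blast
  obtain u v where uv: "u \<in> polys_over K" "v \<in> polys_over K" "r = u * p + v * g" and "r \<noteq> 0"
    using r(1) by (auto simp: J_def)
  have rK: "r \<in> polys_over K" using uv p gh polys_over_add polys_over_mult by auto
  have div: "\<exists>s\<in>polys_over K. z = s * r"
    if z: "z = a * p + b * g" "a \<in> polys_over K" "b \<in> polys_over K" for z a b
  proof -
    have "z \<in> polys_over K" using z p gh polys_over_add polys_over_mult by auto
    then obtain s t where st: "s \<in> polys_over K" "t \<in> polys_over K" "z = s * r + t" "t = 0 \<or> degree t < degree r"
      using division_with_remainder rK \<open>r \<noteq> 0\<close> by blast
    have "t = (a - s * u) * p + (b - s * v) * g" using st(3) z uv by (simp add: algebra_simps)
    moreover have "a - s * u \<in> polys_over K" "b - s * v \<in> polys_over K"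
      using st z uv polys_over_diff polys_over_mult by auto
    ultimately have "J t" if "t \<noteq> 0" using that unfolding J_def by blast
    hence "t = 0" using st(4) r(2)[of t] by (meson not_less)
    thus ?thesis using st by auto
  qed
  obtain s where s: "s \<in> polys_over K" "p = s * r" using div[of p 1 0] polys_over_0 polys_over_1 by auto
  obtain s' where s': "s' \<in> polys_over K" "g = s' * r" using div[of g 0 1] polys_over_0 polys_over_1 by auto
  consider "degree r = 0" | "degree s = 0" using irr[OF s(1) rK s(2)] by auto
  thus ?thesis
  proof cases
    case 1
    then obtain e where e: "r = [:e:]" by (metis degree_eq_zeroE)
    have "e \<in> K" "e \<noteq> 0" using polys_overD[OF rK, of 0] \<open>r \<noteq> 0\<close> e by auto
    have "smult e h = r * h" by (simp add: e)
    also have "\<dots> = u * p * h + v * (g * h)" by (simp add: uv(3) algebra_simps)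
    also have "\<dots> = p * (u * h + v * c)" by (simp add: gh(4) algebra_simps)
    finally have "h = p * smult (inverse e) (u * h + v * c)"
      using \<open>e \<noteq> 0\<close> by (metis left_inverse mult_smult_right smult_1_left smult_smult)
    moreover have "smult (inverse e) (u * h + v * c) \<in> polys_over K"
      using uv gh \<open>e \<in> K\<close> by (intro polys_over_smult polys_over_add polys_over_mult inverse_mem)
    ultimately show ?thesis by blast
  next
    case 2
    then obtain e where e: "s = [:e:]" by (metis degree_eq_zeroE)
    have "e \<in> K" "e \<noteq> 0" using polys_overD[OF s(1), of 0] s(2) p e by auto
    have "g = p * smult (inverse e) s'" using s s' e \<open>e \<noteq> 0\<close> by simp
    moreover have "smult (inverse e) s' \<in> polys_over K"
      using s' \<open>e \<in> K\<close> by (intro polys_over_smult inverse_mem)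
    ultimately show ?thesis by blast
  qed
qed

text \<open>
  A polynomial of positive degree either splits into factors of smaller degree or is prime by Euclid's lemma.
\<close>

lemma ufd_adjoin:
  assumes x: "transcendental_over K x" shows "ufd (adjoin K x)"
proof -
  let ?B = "adjoin K x"
  interpret B: field_subring ?B by (rule adjoin_subring)
  have fac: "\<exists>u ps. unit_in ?B u \<and> (\<forall>q\<in>set ps. prime_in ?B q) \<and> poly p x = u * prod_list ps"
    if "p \<in> polys_over K" "p \<noteq> 0" for p
    using that
  proof (induction "degree p" arbitrary: p rule: less_induct)
    case less
    show ?case
    proof (cases "degree p = 0")
      case True
      then obtain e where e: "p = [:e:]" by (metis degree_eq_zeroE)
      have "e \<in> K" "e \<noteq> 0" using polys_overD[OF less.prems(1), of 0] less.prems e by auto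
      hence "unit_in ?B e" using inverse_mem[of e] subset_adjoin by (auto simp: unit_in_def)
      thus ?thesis by (intro exI[of _ e] exI[of _ "[]"]) (auto simp: e)
    next
      case False
      show ?thesis
      proof (cases "\<exists>g\<in>polys_over K. \<exists>h\<in>polys_over K. p = g * h \<and> degree g \<noteq> 0 \<and> degree h \<noteq> 0")
        case True
        then obtain g h where gh: "g \<in> polys_over K" "h \<in> polys_over K" "p = g * h" "degree g \<noteq> 0" "degree h \<noteq> 0"
          by blast
        have nz: "g \<noteq> 0" "h \<noteq> 0" using gh less.prems by auto
        have "degree p = degree g + degree h" using nz by (simp add: gh degree_mult_eq)
        hence less': "degree g < degree p" "degree h < degree p" using gh by auto
        obtain u ps where 1: "unit_in ?B u" "\<forall>q\<in>set ps. prime_in ?B q" "poly g x = u * prod_list ps"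
          using less.hyps[OF less'(1) gh(1) nz(1)] by blast
        obtain v qs where 2: "unit_in ?B v" "\<forall>q\<in>set qs. prime_in ?B q" "poly h x = v * prod_list qs"
          using less.hyps[OF less'(2) gh(2) nz(2)] by blast
        show ?thesis using 1 2 B.unit_in_mult gh(3)
          by (intro exI[of _ "u * v"] exI[of _ "ps @ qs"]) auto
      next
        case irr: False
        have nz: "poly p x \<noteq> 0" using x less.prems by (auto simp: transcendental_over_def)
        have "prime_in ?B (poly p x)"
          unfolding prime_in_def
        proof (intro conjI ballI impI nz)
          show "poly p x \<in> ?B" using less.prems by (auto simp: adjoin_def)
          show "inverse (poly p x) \<notin> ?B"
          proof
            assume "inverse (poly p x) \<in> ?B"
            then obtain q where q: "q \<in> polys_over K" "inverse (poly p x) = poly q x" by (auto simp: adjoin_def)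
            have "p * q = 1"
              using q nz less.prems by (intro transcendental_over_eqD[OF x] polys_over_mult polys_over_1) (auto simp flip: q(2))
            hence "degree p + degree q = 0" by (metis degree_1 degree_mult_eq mult_zero_left mult_zero_right zero_neq_one)
            thus False using False by simp
          qed
          fix a b assume "a \<in> ?B" "b \<in> ?B" "a * b / poly p x \<in> ?B"
          then obtain g h c where ghc: "g \<in> polys_over K" "h \<in> polys_over K" "c \<in> polys_over K"
            "a = poly g x" "b = poly h x" "a * b / poly p x = poly c x" by (auto simp: adjoin_def)
          have "g * h = p * c"
            using ghc nz less.prems by (intro transcendental_over_eqD[OF x] polys_over_mult) (auto simp: field_simps)
          then obtain k where "k \<in> polys_over K" "g = p * k \<or> h = p * k"
            using irreducible_poly_divides[of p g h c] less.prems ghc irr False by blast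
          thus "a / poly p x \<in> ?B \<or> b / poly p x \<in> ?B" using ghc nz by (auto simp: adjoin_def)
        qed
        thus ?thesis by (intro exI[of _ 1] exI[of _ "[poly p x]"]) (auto simp: B.unit_in_one)
      qed
    qed
  qed
  show ?thesis unfolding ufd_def
  proof (intro conjI ballI impI B.field_subring_axioms)
    fix a assume "a \<in> ?B" "a \<noteq> 0"
    then obtain p where "p \<in> polys_over K" "a = poly p x" "p \<noteq> 0" unfolding adjoin_def by force
    thus "\<exists>u ps. unit_in ?B u \<and> (\<forall>q\<in>set ps. prime_in ?B q) \<and> a = u * prod_list ps" using fac by blast
  qed
qed

end

definition fractions :: "'f::field set \<Rightarrow> 'f set" where
  "fractions A = {a / b |a b. a \<in> A \<and> b \<in> A \<and> b \<noteq> 0}"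

context field_subring begin

lemma fractionsI: "a \<in> A \<Longrightarrow> b \<in> A \<Longrightarrow> b \<noteq> 0 \<Longrightarrow> c = a / b \<Longrightarrow> c \<in> fractions A"
  by (auto simp: fractions_def)

lemma fractions_subfield: "subfield_of_field (fractions A)"
proof
  show "1 \<in> fractions A" by (rule fractionsI[of 1 1]) auto
  fix p assume "p \<in> fractions A"
  then obtain a b where ab: "a \<in> A" "b \<in> A" "b \<noteq> 0" "p = a / b" by (auto simp: fractions_def)
  show "- p \<in> fractions A" by (rule fractionsI[of "- a" b]) (use ab in \<open>auto simp: uminus_mem\<close>)
  show "inverse p \<in> fractions A"
  proof (cases "a = 0")
    case True thus ?thesis using ab by (intro fractionsI[of 0 1]) auto
  next
    case False thus ?thesis using ab by (intro fractionsI[of b a]) auto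
  qed
  fix q assume "q \<in> fractions A"
  then obtain c d where cd: "c \<in> A" "d \<in> A" "d \<noteq> 0" "q = c / d" by (auto simp: fractions_def)
  show "p + q \<in> fractions A"
    by (rule fractionsI[of "a * d + c * b" "b * d"]) (use ab cd in \<open>auto simp: add_mem mult_mem field_simps\<close>)
  show "p * q \<in> fractions A"
    by (rule fractionsI[of "a * c" "b * d"]) (use ab cd in \<open>auto simp: mult_mem\<close>)
qed

lemma subset_fractions: "A \<subseteq> fractions A"
  by (auto intro: fractionsI[of _ 1])

lemma common_denominator:
  assumes "p \<in> polys_over (fractions A)"
  shows "\<exists>a\<in>A. a \<noteq> 0 \<and> smult a p \<in> polys_over A"
  using assms
proof (induction p)
  case 0 thus ?case by (auto intro!: bexI[of _ 1] polys_over_0)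
next
  case (pCons c p)
  have "p \<in> polys_over (fractions A)" "c \<in> fractions A"
    using polys_overD[OF pCons.prems, of "Suc _"] polys_overD[OF pCons.prems, of 0] by (auto simp: polys_over_def)
  then obtain a a' b where *: "a \<in> A" "a \<noteq> 0" "smult a p \<in> polys_over A" "a' \<in> A" "b \<in> A" "b \<noteq> 0" "c = a' / b"
    using pCons.IH by (auto simp: fractions_def)
  have "smult (a * b) (pCons c p) = pCons (a * a') (smult b (smult a p))"
    using * by (simp add: mult.commute)
  hence "smult (a * b) (pCons c p) \<in> polys_over A"
    using * by (simp add: polys_over_pCons polys_over_smult mult_mem del: smult_smult)
  thus ?case using * mult_mem[of a b] by (intro bexI[of _ "a * b"]) auto
qed

lemma transcendental_over_fractions:
  assumes x: "transcendental_over A x" shows "transcendental_over (fractions A) x"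
  unfolding transcendental_over_def
proof (intro ballI impI)
  fix p assume p: "p \<in> polys_over (fractions A)" "poly p x = 0"
  obtain a where a: "a \<in> A" "a \<noteq> 0" "smult a p \<in> polys_over A" using common_denominator[OF p(1)] by blast
  hence "smult a p = 0" using x p(2) unfolding transcendental_over_def by (metis mult_zero_right poly_smult)
  thus "p = 0" using a(2) by simp
qed

end

text \<open>
  Nagata's theorem with \<open>Q\<close> the set of all primes of \<open>A\<close>, which remain prime in \<open>A[x]\<close>: inverting them
  turns \<open>A\<close> into its quotient field \<open>K\<close>, and \<open>K[x]\<close> is factorial by the Euclidean algorithm.
  Constants that divide a polynomial divide its leading coefficient, which bounds their number of prime factors.
\<close>

theorem gauss_ufd_adjoin:
  assumes A: "ufd A" and x: "transcendental_over A x"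
  shows "ufd (adjoin A x)"
proof -
  interpret field_subring A by (rule ufd_subring) fact
  interpret K: subfield_of_field "fractions A" by (rule fractions_subfield)
  show ?thesis
  proof (rule nagata_ufd[where B = "adjoin (fractions A) x" and Q = "{p. prime_in A p}"])
    show "field_subring (adjoin A x)" by (rule adjoin_subring)
    show "ufd (adjoin (fractions A) x)" by (rule K.ufd_adjoin[OF transcendental_over_fractions[OF x]])
    show "adjoin A x \<subseteq> adjoin (fractions A) x"
      using subset_fractions by (auto simp: adjoin_def polys_over_def)
    fix q assume q: "q \<in> {p. prime_in A p}"
    show "prime_in (adjoin A x) q" using prime_in_adjoin[OF x] q by auto
    have "inverse q \<in> fractions A" using q by (intro fractionsI[of 1 q]) (auto dest: prime_inD simp: divide_inverse)
    thus "inverse q \<in> adjoin (fractions A) x" using K.subset_adjoin by auto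
  next
    fix b assume "b \<in> adjoin (fractions A) x"
    then obtain p where p: "p \<in> polys_over (fractions A)" "b = poly p x" by (auto simp: adjoin_def)
    obtain a where a: "a \<in> A" "a \<noteq> 0" "smult a p \<in> polys_over A" using common_denominator[OF p(1)] by blast
    obtain u ps where u: "unit_in A u" "\<forall>p\<in>set ps. prime_in A p" "a = u * prod_list ps"
      using ufd_factor[OF A a(1,2)] .
    have "smult (inverse u) (smult a p) \<in> polys_over A"
      using polys_over_smult[OF _ a(3)] u(1) by (simp add: unit_in_def del: smult_smult)
    moreover have "poly (smult (inverse u) (smult a p)) x = prod_list ps * b"
      using u p by (simp add: unit_in_def field_simps)
    ultimately have "prod_list ps * b \<in> adjoin A x" by (rule adjoinI)
    thus "\<exists>qs. set qs \<subseteq> {p. prime_in A p} \<and> prod_list qs * b \<in> adjoin A x" using u(2) by auto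
  next
    fix a assume "a \<in> adjoin A x" "a \<noteq> 0"
    then obtain f where f: "f \<in> polys_over A" "a = poly f x" "f \<noteq> 0" unfolding adjoin_def by force
    obtain N where N: "\<And>qs. \<forall>q\<in>set qs. prime_in A q \<Longrightarrow> lead_coeff f / prod_list qs \<in> A \<Longrightarrow> length qs \<le> N"
      using ufd_prime_divisors_bounded[OF A polys_overD[OF f(1)], of "degree f"] f(3) by auto
    have "length qs \<le> N" if qs: "set qs \<subseteq> {p. prime_in A p}" and aqs: "a / prod_list qs \<in> adjoin A x" for qs
    proof (rule N)
      show "\<forall>q\<in>set qs. prime_in A q" using qs by auto
      have nz: "prod_list qs \<noteq> 0" using qs by (intro prod_list_primes_nonzero[of qs A]) auto
      have mem: "prod_list qs \<in> A" using qs by (intro prod_list_mem) (auto dest: prime_inD)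
      obtain g where g: "g \<in> polys_over A" "a / prod_list qs = poly g x" using aqs by (auto simp: adjoin_def)
      have "f = smult (prod_list qs) g"
        using f g nz mem by (intro transcendental_over_eqD[OF x] polys_over_smult) (auto simp: field_simps)
      hence "lead_coeff f / prod_list qs = coeff g (degree f)" using nz by (metis coeff_smult nonzero_mult_div_cancel_left)
      thus "lead_coeff f / prod_list qs \<in> A" using polys_overD[OF g(1)] by simp
    qed
    thus "\<exists>N. \<forall>qs. set qs \<subseteq> {p. prime_in A p} \<longrightarrow> a / prod_list qs \<in> adjoin A x \<longrightarrow> length qs \<le> N" by blast
  qed
qed

section \<open>Polynomial rings in several algebraically independent elements\<close>

lemma amb_simps [simp]:
  "carrier amb = UNIV" "a \<otimes>\<^bsub>amb\<^esub> b = a * b" "\<one>\<^bsub>amb\<^esub> = 1" "\<zero>\<^bsub>amb\<^esub> = 0" "a \<oplus>\<^bsub>amb\<^esub> b = a + b"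
  by (simp_all add: ring_of_type_algebra_def)

lemma amb_a_inv [simp]: "\<ominus>\<^bsub>amb\<^esub> a = - (a :: 'f::field)"
proof -
  interpret amb: Ring.field "amb :: 'f ring" by (rule field_from_type_algebra)
  show ?thesis using amb.minus_equality[of "- a" a] by simp
qed

lemma generate_ring_subring: "field_subring (generate_ring amb H)"
proof
  show "1 \<in> generate_ring amb H" using generate_ring.one[of amb H] by simp
  fix a assume a: "a \<in> generate_ring amb H"
  show "- a \<in> generate_ring amb H" using generate_ring.a_inv[OF a] by simp
  fix b assume b: "b \<in> generate_ring amb H"
  show "a + b \<in> generate_ring amb H" using generate_ring.eng_add[OF a b] by simp
  show "a * b \<in> generate_ring amb H" using generate_ring.eng_mult[OF a b] by simp
qed

lemma generate_ring_least:
  assumes "field_subring A" "H \<subseteq> A" shows "generate_ring amb H \<subseteq> A"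
proof
  interpret field_subring A by fact
  fix a assume "a \<in> generate_ring amb H"
  thus "a \<in> A" using assms(2)
    by induction (auto simp: uminus_mem add_mem mult_mem)
qed

text \<open>
  The index set is a parameter so that variables can be adjoined or left out one at a time.
\<close>

definition polynomials_in :: "'f::field set \<Rightarrow> (nat \<Rightarrow> 'f) \<Rightarrow> nat set \<Rightarrow> 'f set" where
  "polynomials_in R y J = generate_ring amb (R \<union> y ` J)"

lemma polynomials_in_subring: "field_subring (polynomials_in R y J)"
  unfolding polynomials_in_def by (rule generate_ring_subring)

lemma polynomials_in_base: "R \<subseteq> polynomials_in R y J"
  unfolding polynomials_in_def by (auto intro: generate_ring.incl)

lemma polynomials_in_variable: "k \<in> J \<Longrightarrow> y k \<in> polynomials_in R y J"
  unfolding polynomials_in_def by (auto intro: generate_ring.incl)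

lemma polynomials_in_least: "field_subring A \<Longrightarrow> R \<subseteq> A \<Longrightarrow> y ` J \<subseteq> A \<Longrightarrow> polynomials_in R y J \<subseteq> A"
  unfolding polynomials_in_def by (rule generate_ring_least) auto

lemma polynomials_in_mono: "J \<subseteq> J' \<Longrightarrow> polynomials_in R y J \<subseteq> polynomials_in R y J'"
  using polynomials_in_variable[of _ J' y R]
  by (intro polynomials_in_least polynomials_in_subring polynomials_in_base) auto

lemma polynomials_in_cong: "(\<And>k. k \<in> J \<Longrightarrow> y k = z k) \<Longrightarrow> polynomials_in R y J = polynomials_in R z J"
  unfolding polynomials_in_def using image_cong[of J J y z] by simp

lemma polynomials_in_empty:
  assumes "field_subring R" shows "polynomials_in R y {} = R"
  using polynomials_in_least[OF assms, of R y "{}"] polynomials_in_base[of R y "{}"] by auto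

lemma polynomials_in_insert: "polynomials_in R y (insert k J) = adjoin (polynomials_in R y J) (y k)"
proof
  interpret A: field_subring "polynomials_in R y J" by (rule polynomials_in_subring)
  interpret P: field_subring "polynomials_in R y (insert k J)" by (rule polynomials_in_subring)
  show "polynomials_in R y (insert k J) \<subseteq> adjoin (polynomials_in R y J) (y k)"
    using polynomials_in_base[of R y J] polynomials_in_variable[of _ J y R] A.subset_adjoin[of "y k"] A.mem_adjoin[of "y k"]
    by (intro polynomials_in_least A.adjoin_subring) blast+
  show "adjoin (polynomials_in R y J) (y k) \<subseteq> polynomials_in R y (insert k J)"
  proof
    fix a assume "a \<in> adjoin (polynomials_in R y J) (y k)"
    then obtain p where p: "p \<in> polys_over (polynomials_in R y J)" "a = poly p (y k)" by (auto simp: adjoin_def)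
    have "coeff p i \<in> polynomials_in R y (insert k J)" for i
      using polys_overD[OF p(1)] polynomials_in_mono[of J "insert k J" R y] by auto
    moreover have "y k \<in> polynomials_in R y (insert k J)" by (rule polynomials_in_variable) simp
    ultimately show "a \<in> polynomials_in R y (insert k J)"
      unfolding p(2) poly_altdef by (intro P.sum_mem P.mult_mem P.power_mem)
  qed
qed

definition variable_monomial :: "nat \<Rightarrow> (nat \<Rightarrow> 'f::field) \<Rightarrow> (nat \<Rightarrow> nat) \<Rightarrow> 'f" where
  "variable_monomial N y e = (\<Prod>k\<in>{1..N}. y k ^ e k)"

text \<open>
  The exponent vectors on \<open>{1..N}\<close> of monomials in the variables with index in \<open>J\<close>. They are functions
  on all of \<open>{1..N}\<close> because algebraic independence is stated in terms of these.
\<close>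

definition exponents :: "nat \<Rightarrow> nat set \<Rightarrow> (nat \<Rightarrow> nat) set" where
  "exponents N J = {e \<in> {1..N} \<rightarrow>\<^sub>E UNIV. \<forall>k\<in>{1..N} - J. e k = 0}"

text \<open>
  Sums of terms, in which an exponent vector may occur repeatedly. Closure under multiplication is
  easier to see in this form than for sums with distinct exponent vectors, to which
  algebraic independence applies; \<open>monomial_span_normal_form\<close> collects the terms afterwards.
\<close>

inductive_set monomial_span :: "'f::field set \<Rightarrow> nat \<Rightarrow> (nat \<Rightarrow> 'f) \<Rightarrow> nat set \<Rightarrow> 'f set"
  for R N y J where
    zero: "0 \<in> monomial_span R N y J"
  | add_term: "\<lbrakk>r \<in> R; e \<in> exponents N J; t \<in> monomial_span R N y J\<rbrakk>
           \<Longrightarrow> r * variable_monomial N y e + t \<in> monomial_span R N y J"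

lemma monomial_span_subring:
  assumes R: "field_subring R" shows "field_subring (monomial_span R N y J)"
proof
  interpret field_subring R by (rule R)
  let ?S = "monomial_span R N y J"
  show "1 \<in> ?S"
  proof -
    have "(\<lambda>k\<in>{1..N}. 0) \<in> exponents N J" by (auto simp: exponents_def)
    from monomial_span.add_term[OF one_mem this monomial_span.zero] show ?thesis
      by (simp add: variable_monomial_def)
  qed
  show "- a \<in> ?S" if "a \<in> ?S" for a
    using that
  proof induction
    case (add_term r e t)
    from monomial_span.add_term[OF uminus_mem[OF add_term(1)] add_term(2) add_term(4)] show ?case by simp
  qed (simp add: monomial_span.zero)
  show add: "a + b \<in> ?S" if "a \<in> ?S" "b \<in> ?S" for a b
    using that(1)
  proof induction
    case (add_term r e t)
    from monomial_span.add_term[OF add_term(1,2,4)] show ?case by (simp add: add.assoc)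
  qed (simp add: that)
  have mono: "r * variable_monomial N y e * b \<in> ?S" if "r \<in> R" "e \<in> exponents N J" "b \<in> ?S" for r e b
    using that(3)
  proof induction
    case (add_term r' e' t)
    define e'' where "e'' = (\<lambda>k\<in>{1..N}. e k + e' k)"
    have "e'' \<in> exponents N J" using that(2) add_term(2) by (auto simp: e''_def exponents_def)
    moreover have "variable_monomial N y e'' = variable_monomial N y e * variable_monomial N y e'"
      by (simp add: e''_def variable_monomial_def power_add flip: prod.distrib)
    ultimately have "r * r' * (variable_monomial N y e * variable_monomial N y e') + r * variable_monomial N y e * t \<in> ?S"
      using monomial_span.add_term[OF mult_mem[OF that(1) add_term(1)] _ add_term(4)] by metis
    thus ?case by (simp add: algebra_simps)
  qed (simp add: monomial_span.zero)
  show "a * b \<in> ?S" if "a \<in> ?S" "b \<in> ?S" for a b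
    using that(1)
  proof induction
    case (add_term r e t)
    from add[OF mono[OF add_term(1,2) that(2)] add_term(4)] show ?case by (simp add: algebra_simps)
  qed (simp add: monomial_span.zero)
qed

lemma polynomials_in_subset_monomial_span:
  assumes R: "field_subring R" and J: "J \<subseteq> {1..N}"
  shows "polynomials_in R y J \<subseteq> monomial_span R N y J"
proof (rule polynomials_in_least)
  interpret field_subring R by (rule R)
  show "field_subring (monomial_span R N y J)" by (rule monomial_span_subring[OF R])
  have "(\<lambda>k\<in>{1..N}. 0) \<in> exponents N J" by (auto simp: exponents_def)
  from monomial_span.add_term[OF _ this monomial_span.zero] show "R \<subseteq> monomial_span R N y J"
    by (auto simp: variable_monomial_def)
  show "y ` J \<subseteq> monomial_span R N y J"
  proof
    fix a assume "a \<in> y ` J"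
    then obtain k where k: "k \<in> J" "a = y k" by auto
    define e where "e = (\<lambda>j\<in>{1..N}. if j = k then 1 else 0 :: nat)"
    have "e \<in> exponents N J" using k by (auto simp: exponents_def e_def)
    moreover have "variable_monomial N y e = (\<Prod>j\<in>{1..N}. if j = k then y k else 1)"
      unfolding variable_monomial_def e_def by (intro prod.cong) auto
    hence "variable_monomial N y e = y k" using k J by (auto simp: prod.delta)
    ultimately show "a \<in> monomial_span R N y J"
      using monomial_span.add_term[OF one_mem _ monomial_span.zero, of e N J y] k by simp
  qed
qed

lemma monomial_span_normal_form:
  assumes R: "field_subring R" and "a \<in> monomial_span R N y J"
  shows "\<exists>E c. finite E \<and> E \<subseteq> exponents N J \<and> c ` E \<subseteq> R \<and> a = (\<Sum>e\<in>E. c e * variable_monomial N y e)"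
  using assms(2)
proof induction
  case zero
  show ?case by (intro exI[of _ "{}"]) auto
next
  case (add_term r e t)
  interpret field_subring R by (rule R)
  obtain E c where E: "finite E" "E \<subseteq> exponents N J" "c ` E \<subseteq> R" "t = (\<Sum>e\<in>E. c e * variable_monomial N y e)"
    using add_term.IH by blast
  define c' where "c' = c(e := if e \<in> E then r + c e else r)"
  have "(\<Sum>b\<in>insert e E. c' b * variable_monomial N y b) =
        c' e * variable_monomial N y e + (\<Sum>b\<in>E - {e}. c' b * variable_monomial N y b)"
    using E(1) by (simp add: sum.insert_remove)
  also have "(\<Sum>b\<in>E - {e}. c' b * variable_monomial N y b) = (\<Sum>b\<in>E - {e}. c b * variable_monomial N y b)"
    by (intro sum.cong) (auto simp: c'_def)
  also have "c' e * variable_monomial N y e + \<dots> = r * variable_monomial N y e + t"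
    using E(1) by (auto simp: E(4) c'_def sum.remove[of E e] algebra_simps)
  finally show ?case
    using E add_term.hyps add_mem
    by (intro exI[of _ "insert e E"] exI[of _ c']) (auto simp: c'_def)
qed

text \<open>
  Writing the coefficients of \<open>p\<close> in normal form makes \<open>p (y k)\<close> a combination of monomials; distinct
  pairs of a power of \<open>y k\<close> and an exponent vector that vanishes at \<open>k\<close> give distinct monomials.
\<close>

lemma alg_independent_transcendental:
  assumes R: "field_subring R" and ind: "alg_independent R N y"
    and J: "J \<subseteq> {1..N}" and k: "k \<in> {1..N}" "k \<notin> J"
  shows "transcendental_over (polynomials_in R y J) (y k)"
  unfolding transcendental_over_def
proof (intro ballI impI)
  fix p assume p: "p \<in> polys_over (polynomials_in R y J)" "poly p (y k) = 0"
  have "\<exists>E c. finite E \<and> E \<subseteq> exponents N J \<and> c ` E \<subseteq> R \<and> coeff p i = (\<Sum>e\<in>E. c e * variable_monomial N y e)" for i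
    by (rule monomial_span_normal_form[OF R subsetD[OF polynomials_in_subset_monomial_span[OF R J] polys_overD[OF p(1)]]])
  then obtain E c where E: "\<And>i. finite (E i)" "\<And>i. E i \<subseteq> exponents N J" "\<And>i. c i ` E i \<subseteq> R"
    "\<And>i. coeff p i = (\<Sum>e\<in>E i. c i e * variable_monomial N y e)" by metis
  define S where "S = Sigma {..degree p} E"
  \<comment> \<open>The term with exponents \<open>e\<close> in the coefficient of degree \<open>i\<close> contributes the exponents \<open>g (i, e)\<close>.\<close>
  define g :: "nat \<times> (nat \<Rightarrow> nat) \<Rightarrow> nat \<Rightarrow> nat" where "g = (\<lambda>(i, e). e(k := i))"
  have ek: "e k = 0" if "(i, e) \<in> S" for i e
    using that E(2)[of i] k by (auto simp: S_def exponents_def)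
  have inj: "inj_on g S"
  proof (rule inj_onI)
    fix s t assume "s \<in> S" "t \<in> S" "g s = g t"
    moreover obtain i e j b where "s = (i, e)" "t = (j, b)" by (cases s, cases t)
    ultimately have eq: "e(k := i) = b(k := j)" "e k = 0" "b k = 0" and st: "s = (i, e)" "t = (j, b)"
      using ek by (auto simp: g_def)
    have "i = j" using fun_cong[OF eq(1), of k] by simp
    moreover have "e = b"
    proof
      fix l show "e l = b l" using fun_cong[OF eq(1), of l] eq(2,3) by (cases "l = k") auto
    qed
    ultimately show "s = t" using st by simp
  qed
  have fin: "finite S" using E(1) by (auto simp: S_def)
  define c' where "c' b = (case inv_into S g b of (i, e) \<Rightarrow> c i e)" for b
  have c': "c' (g (i, e)) = c i e" if "(i, e) \<in> S" for i e
    using inv_into_f_f[OF inj that] by (simp add: c'_def)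
  have mon: "variable_monomial N y (g (i, e)) = variable_monomial N y e * y k ^ i" if "(i, e) \<in> S" for i e
  proof -
    have "(\<Prod>l\<in>{1..N} - {k}. y l ^ (e(k := i)) l) = (\<Prod>l\<in>{1..N} - {k}. y l ^ e l)"
      by (intro prod.cong) auto
    thus ?thesis using ek[OF that] unfolding variable_monomial_def g_def
      by (simp add: prod.remove[OF finite_atLeastAtMost k(1)] ac_simps del: One_nat_def)
  qed
  have "(\<Sum>b\<in>g ` S. c' b * variable_monomial N y b) = (\<Sum>s\<in>S. c' (g s) * variable_monomial N y (g s))"
    by (simp add: sum.reindex[OF inj])
  also have "\<dots> = (\<Sum>(i, e)\<in>S. c i e * variable_monomial N y e * y k ^ i)"
    by (intro sum.cong) (auto simp: c' mon)
  also have "\<dots> = (\<Sum>i\<le>degree p. \<Sum>e\<in>E i. c i e * variable_monomial N y e * y k ^ i)"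
    unfolding S_def using E(1) by (subst sum.Sigma) auto
  also have "\<dots> = poly p (y k)" by (simp add: poly_altdef E(4) sum_distrib_right)
  finally have "(\<Sum>b\<in>g ` S. c' b * (\<Prod>k\<in>{1..N}. y k ^ b k)) = 0"
    using p(2) by (simp add: variable_monomial_def)
  moreover have "g ` S \<subseteq> {1..N} \<rightarrow>\<^sub>E UNIV"
  proof
    fix b assume "b \<in> g ` S"
    then obtain i e where "e \<in> E i" "b = e(k := i)" by (auto simp: S_def g_def)
    thus "b \<in> {1..N} \<rightarrow>\<^sub>E UNIV" using E(2)[of i] k(1) by (auto simp: exponents_def PiE_iff extensional_def)
  qed
  moreover have "c' ` g ` S \<subseteq> R" using E(3) c' by (fastforce simp: S_def)
  ultimately have zero: "\<forall>b\<in>g ` S. c' b = 0" using ind fin unfolding alg_independent_def by blast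
  have "coeff p i = 0" for i
  proof (cases "i \<le> degree p")
    case True
    hence "c i e = 0" if "e \<in> E i" for e using zero c'[of i e] that by (auto simp: S_def)
    thus ?thesis by (simp add: E(4))
  qed (simp add: coeff_eq_0)
  thus "p = 0" by (simp add: poly_eq_iff)
qed

lemma ufd_polynomials_in:
  assumes R: "ufd R" and ind: "alg_independent R N y" and J: "J \<subseteq> {1..N}"
  shows "ufd (polynomials_in R y J)"
proof -
  have "finite J" using J finite_subset by auto
  thus ?thesis using J
  proof induction
    case empty thus ?case using R polynomials_in_empty[OF ufd_subring[OF R]] by simp
  next
    case (insert k J)
    show ?case unfolding polynomials_in_insert
      using insert by (intro gauss_ufd_adjoin alg_independent_transcendental[OF ufd_subring[OF R] ind]) auto
  qed
qed

section \<open>The base ring\<close>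

lemma ufd_Ints: "ufd (\<int> :: 'f::field_char_0 set)"
  unfolding ufd_def
proof (intro conjI ballI impI)
  interpret field_subring "\<int> :: 'f set" by unfold_locales auto
  show "field_subring (\<int> :: 'f set)" by (rule field_subring_axioms)
  have div: "(of_int a / of_int p :: 'f) \<in> \<int> \<longleftrightarrow> p dvd a" if "p \<noteq> 0" for a p :: int
  proof
    assume "(of_int a / of_int p :: 'f) \<in> \<int>"
    then obtain c where "(of_int a / of_int p :: 'f) = of_int c" by (elim Ints_cases)
    hence "(of_int a :: 'f) = of_int (p * c)" using that by (simp add: field_simps)
    hence "a = p * c" by (simp only: of_int_eq_iff)
    thus "p dvd a" by simp
  next
    assume "p dvd a"
    then obtain c where "a = p * c" by (elim dvdE)
    thus "(of_int a / of_int p :: 'f) \<in> \<int>" using that by simp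
  qed
  have prime: "prime_in \<int> (of_int p :: 'f)" if p: "Factorial_Ring.prime p" for p :: int
    unfolding prime_in_def
  proof (intro conjI ballI impI)
    have nz: "p \<noteq> 0" using p by auto
    show "of_int p \<noteq> (0::'f)" "of_int p \<in> (\<int> :: 'f set)" using nz by auto
    show "inverse (of_int p) \<notin> (\<int> :: 'f set)"
      using div[OF nz, of 1] p by (auto simp: divide_inverse not_prime_unit)
    fix a b :: 'f assume "a \<in> \<int>" "b \<in> \<int>" and ab: "a * b / of_int p \<in> \<int>"
    then obtain k l where "a = of_int k" "b = of_int l" by (elim Ints_cases)
    thus "a / of_int p \<in> \<int> \<or> b / of_int p \<in> \<int>"
      using ab div[OF nz, of "k * l"] div[OF nz] prime_dvd_multD[OF p, of k l] by auto
  qed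
  fix a :: 'f assume "a \<in> \<int>" "a \<noteq> 0"
  then obtain z where z: "a = of_int z" "z \<noteq> 0" by (elim Ints_cases) auto
  obtain ps where ps: "mset ps = prime_factorization z" using ex_mset by blast
  have "prod_list ps = prod_mset (prime_factorization z)" by (simp add: prod_mset_prod_list flip: ps)
  also have "\<dots> = normalize z" by (rule prod_mset_prime_factorization[OF z(2)])
  finally have "prod_list ps = normalize z" .
  moreover have "z = sgn z * normalize z" by (simp add: sgn_mult_abs)
  moreover have "(of_int (prod_list ps) :: 'f) = prod_list (map of_int ps)" by (induction ps) auto
  ultimately have "a = of_int (sgn z) * prod_list (map of_int ps)" using z(1) by (metis of_int_mult)
  moreover have "unit_in \<int> (of_int (sgn z) :: 'f)" using z(2) by (auto simp: unit_in_def sgn_if)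
  moreover have "\<forall>p\<in>set (map of_int ps). prime_in \<int> (p :: 'f)"
  proof
    fix q :: 'f assume "q \<in> set (map of_int ps)"
    then obtain p where "p \<in># prime_factorization z" "q = of_int p" by (auto simp flip: ps)
    thus "prime_in \<int> q" using prime by auto
  qed
  ultimately show "\<exists>u ps. unit_in \<int> u \<and> (\<forall>p\<in>set ps. prime_in \<int> p) \<and> a = u * prod_list ps" by blast
qed

lemma ufd_subfield:
  assumes "subfield R (amb :: 'f::field ring)" shows "ufd R"
proof -
  interpret amb: Ring.field "amb :: 'f ring" by (rule field_from_type_algebra)
  interpret R: subfield R amb by fact
  note sub = subringE[OF R.subring_axioms]
  interpret field_subring R
    using sub(3,5,6,7) by unfold_locales auto
  have "unit_in R a" if "a \<in> R" "a \<noteq> 0" for a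
  proof -
    have "a \<in> Units (amb\<lparr>carrier := R\<rparr>)" using R.subfield_Units that by auto
    then obtain b where "b \<in> R" "a * b = 1" by (auto simp: Units_def)
    hence "inverse a \<in> R" by (metis inverse_unique)
    thus ?thesis using that by (auto simp: unit_in_def)
  qed
  thus ?thesis unfolding ufd_def using field_subring_axioms
    by (metis empty_iff empty_set mult.right_neutral prod_list.Nil)
qed

section \<open>Laurent rings\<close>

lemma laurent_subring_subring: "field_subring (laurent_subring R N y)"
  unfolding laurent_subring_def by (rule generate_ring_subring)

lemma laurent_subring_variable:
  assumes "k \<in> {1..N}" shows "y k \<in> laurent_subring R N y" "inverse (y k) \<in> laurent_subring R N y"
  unfolding laurent_subring_def using assms by (auto intro: generate_ring.incl)

lemma polynomials_in_subset_laurent: "J \<subseteq> {1..N} \<Longrightarrow> polynomials_in R y J \<subseteq> laurent_subring R N y"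
  unfolding laurent_subring_def
  by (intro polynomials_in_least generate_ring_subring) (auto intro: generate_ring.incl)

lemma laurent_subring_least:
  assumes "field_subring A" "R \<subseteq> A" "\<And>k. k \<in> {1..N} \<Longrightarrow> y k \<in> A" "\<And>k. k \<in> {1..N} \<Longrightarrow> inverse (y k) \<in> A"
  shows "laurent_subring R N y \<subseteq> A"
  unfolding laurent_subring_def using assms by (intro generate_ring_least) auto

lemma laurent_subring_localization:
  assumes nz: "\<And>k. k \<in> {1..N} \<Longrightarrow> y k \<noteq> 0"
  shows "laurent_subring R N y = localization (polynomials_in R y {1..N}) (\<Prod>k\<in>{1..N}. y k)"
    (is "?L = localization ?P ?q")
proof
  interpret P: field_subring ?P by (rule polynomials_in_subring)
  interpret L: field_subring ?L by (rule laurent_subring_subring)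
  have qP: "?q \<in> ?P" by (intro P.prod_mem polynomials_in_variable)
  show "?L \<subseteq> localization ?P ?q"
  proof (rule laurent_subring_least)
    show "field_subring (localization ?P ?q)" using qP by (intro localization_subring polynomials_in_subring)
    show "R \<subseteq> localization ?P ?q" using polynomials_in_base[of R y "{1..N}"] subset_localization[of ?P ?q] by simp
    fix k assume k: "k \<in> {1..N}"
    show "y k \<in> localization ?P ?q"
      using polynomials_in_variable[OF k, of y R] subset_localization[of ?P ?q] by auto
    have "inverse (y k) * ?q ^ 1 = (\<Prod>k\<in>{1..N} - {k}. y k)"
      using nz[OF k] prod.remove[OF finite_atLeastAtMost k, of y] by simp
    also have "\<dots> \<in> ?P" by (intro P.prod_mem polynomials_in_variable) auto
    finally show "inverse (y k) \<in> localization ?P ?q" unfolding localization_def by blast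
  qed
  show "localization ?P ?q \<subseteq> ?L"
  proof
    fix a assume "a \<in> localization ?P ?q"
    then obtain e where e: "a * ?q ^ e \<in> ?P" by (auto simp: localization_def)
    have "inverse ?q \<in> ?L"
      unfolding prod_inversef[symmetric] by (auto intro!: L.prod_mem laurent_subring_variable)
    hence "(a * ?q ^ e) * inverse ?q ^ e \<in> ?L"
      using e polynomials_in_subset_laurent[of "{1..N}" N R y] L.mult_mem L.power_mem by blast
    moreover have "(a * ?q ^ e) * inverse ?q ^ e = a"
      using nz by (simp add: power_inverse field_simps)
    ultimately show "a \<in> ?L" by (simp only:)
  qed
qed

text \<open>
  This lemma and the next one switch between monomials and the lists of primes
  used for factorizations.
\<close>

lemma power_prod_eq_prod_list:
  fixes y :: "nat \<Rightarrow> 'f::field"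
  assumes "finite J"
  shows "\<exists>qs. set qs \<subseteq> y ` J \<and> prod_list qs = (\<Prod>k\<in>J. y k) ^ e"
proof -
  have "\<exists>qs. set qs \<subseteq> y ` J \<and> prod_list qs = (\<Prod>k\<in>J. y k)"
    using assms
  proof induction
    case empty show ?case by (intro exI[of _ "[]"]) auto
  next
    case (insert k J)
    then obtain qs where "set qs \<subseteq> y ` J" "prod_list qs = (\<Prod>k\<in>J. y k)" by blast
    thus ?case using insert by (intro exI[of _ "y k # qs"]) auto
  qed
  then obtain qs where qs: "set qs \<subseteq> y ` J" "prod_list qs = (\<Prod>k\<in>J. y k)" by blast
  show ?thesis
  proof (induction e)
    case 0 show ?case by (intro exI[of _ "[]"]) auto
  next
    case (Suc e)
    then obtain rs where "set rs \<subseteq> y ` J" "prod_list rs = (\<Prod>k\<in>J. y k) ^ e" by blast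
    thus ?case using qs by (intro exI[of _ "qs @ rs"]) auto
  qed
qed

lemma prod_list_eq_power_prod:
  fixes y :: "nat \<Rightarrow> 'f::field"
  assumes "finite J" "set qs \<subseteq> y ` J"
  shows "\<exists>e. prod_list qs = (\<Prod>k\<in>J. y k ^ e k)"
  using assms(2)
proof (induction qs)
  case Nil show ?case by (intro exI[of _ "\<lambda>_. 0"]) auto
next
  case (Cons q qs)
  then obtain e where e: "prod_list qs = (\<Prod>k\<in>J. y k ^ e k)" by auto
  obtain j where j: "j \<in> J" "q = y j" using Cons.prems by auto
  have "(\<Prod>k\<in>J. y k ^ (e(j := Suc (e j))) k) = (\<Prod>k\<in>J. (if k = j then y j else 1) * y k ^ e k)"
    by (intro prod.cong) auto
  also have "\<dots> = q * prod_list qs"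
    using assms(1) j by (simp add: prod.distrib e)
  finally show ?case by (metis prod_list.Cons)
qed

lemma (in field_subring) unit_in_power_int: "unit_in A u \<Longrightarrow> u powi e \<in> A"
  by (cases e rule: int_cases2) (auto simp: unit_in_def power_int_minus power_mem simp flip: power_inverse)

section \<open>The upper bound of a cluster\<close>

text \<open>
  All that matters about a seed is its cluster \<open>y\<close> and, for each direction \<open>i\<close>, a nonzero polynomial
  \<open>f i\<close> in the variables other than \<open>y i\<close>. The ring \<open>Pc i\<close> of polynomials in these variables is shared by the
  cluster and its mutation in direction \<open>i\<close>.
\<close>

locale exchange_data =
  fixes R :: "'f::field set" and n N :: nat and y f :: "nat \<Rightarrow> 'f"
  assumes base: "ufd R"
    and n_le: "n \<le> N"
    and independent: "alg_independent R N y"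
    and f_mem: "i \<in> {1..n} \<Longrightarrow> f i \<in> polynomials_in R y ({1..N} - {i})"
    and f_nonzero: "i \<in> {1..n} \<Longrightarrow> f i \<noteq> 0"
begin

abbreviation P :: "'f set" where "P \<equiv> polynomials_in R y {1..N}"
abbreviation L :: "'f set" where "L \<equiv> laurent_subring R N y"
abbreviation Pc :: "nat \<Rightarrow> 'f set" where "Pc i \<equiv> polynomials_in R y ({1..N} - {i})"

definition y' :: "nat \<Rightarrow> nat \<Rightarrow> 'f" where "y' i = y(i := f i / y i)"

definition L' :: "nat \<Rightarrow> 'f set" where "L' i = laurent_subring R N (y' i)"

definition S :: "'f set" where "S = L \<inter> (\<Inter>i\<in>{1..n}. L' i)"

sublocale P: field_subring P by (rule polynomials_in_subring)
sublocale L: field_subring L by (rule laurent_subring_subring)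
sublocale Pc: field_subring "Pc i" for i by (rule polynomials_in_subring)
sublocale L': field_subring "L' i" for i unfolding L'_def by (rule laurent_subring_subring)

sublocale S: field_subring S
  unfolding S_def
  by unfold_locales
    (auto simp: L.uminus_mem L.add_mem L.mult_mem L'.uminus_mem L'.add_mem L'.mult_mem)

lemma y'_same [simp]: "y' i i = f i / y i"
  by (simp add: y'_def)

lemma y'_other [simp]: "k \<noteq> i \<Longrightarrow> y' i k = y k"
  by (simp add: y'_def)

lemma y_transcendental: "k \<in> {1..N} \<Longrightarrow> transcendental_over (Pc k) (y k)"
  using alg_independent_transcendental[OF ufd_subring[OF base] independent] by auto

lemma y_nonzero: "k \<in> {1..N} \<Longrightarrow> y k \<noteq> 0"
  using Pc.transcendental_over_nonzero y_transcendental by blast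

lemma P_eq_adjoin: "k \<in> {1..N} \<Longrightarrow> P = adjoin (Pc k) (y k)"
  using polynomials_in_insert[of R y k "{1..N} - {k}"] by (simp add: insert_absorb)

lemma index_mem: "i \<in> {1..n} \<Longrightarrow> i \<in> {1..N}"
  using n_le by auto

lemma mutated_polynomials_eq_adjoin:
  assumes "i \<in> {1..n}" shows "polynomials_in R (y' i) {1..N} = adjoin (Pc i) (f i / y i)"
proof -
  have "polynomials_in R (y' i) ({1..N} - {i}) = Pc i" by (rule polynomials_in_cong) auto
  thus ?thesis
    using polynomials_in_insert[of R "y' i" i "{1..N} - {i}"] index_mem[OF assms] by (simp add: insert_absorb)
qed

lemma y'_transcendental: "i \<in> {1..n} \<Longrightarrow> transcendental_over (Pc i) (f i / y i)"
  using Pc.transcendental_over_exchange y_transcendental index_mem f_mem f_nonzero by blast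

lemma y_prime: "k \<in> {1..N} \<Longrightarrow> prime_in P (y k)"
  using Pc.prime_in_adjoin_variable[OF y_transcendental] P_eq_adjoin by metis

lemma y'_nonzero: "i \<in> {1..n} \<Longrightarrow> k \<in> {1..N} \<Longrightarrow> y' i k \<noteq> 0"
  using y_nonzero[of k] f_nonzero[of i] by (cases "k = i") auto

lemma L'_localization:
  "i \<in> {1..n} \<Longrightarrow> L' i = localization (polynomials_in R (y' i) {1..N}) (\<Prod>k\<in>{1..N}. y' i k)"
  unfolding L'_def by (rule laurent_subring_localization[OF y'_nonzero])

lemma Pc_subset_P: "Pc i \<subseteq> P"
  by (rule polynomials_in_mono) auto

lemma P_subset_L: "P \<subseteq> L"
  by (rule polynomials_in_subset_laurent) auto

lemma Pc_subset_L': "Pc i \<subseteq> L' i"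
proof -
  have "Pc i = polynomials_in R (y' i) ({1..N} - {i})" by (rule polynomials_in_cong) auto
  thus ?thesis using polynomials_in_subset_laurent[of "{1..N} - {i}" N R "y' i"] by (auto simp: L'_def)
qed

lemma y_unit_L: "k \<in> {1..N} \<Longrightarrow> unit_in L (y k)"
  using y_nonzero laurent_subring_variable[of k N y R] by (auto simp: unit_in_def)

lemma y_unit_L': "k \<in> {1..N} \<Longrightarrow> k \<noteq> i \<Longrightarrow> unit_in (L' i) (y k)"
  using y_nonzero laurent_subring_variable[of k N "y' i" R] by (auto simp: unit_in_def L'_def)

lemma y'_unit_L': "i \<in> {1..n} \<Longrightarrow> unit_in (L' i) (f i / y i)"
  using y_nonzero f_nonzero index_mem laurent_subring_variable[of i N "y' i" R]
  by (auto simp: unit_in_def L'_def)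

lemma f_mem_P: "i \<in> {1..n} \<Longrightarrow> f i \<in> P"
  using f_mem Pc_subset_P by blast

lemma f_mem_L': "i \<in> {1..n} \<Longrightarrow> f i \<in> L' i"
  using f_mem Pc_subset_L' by blast

text \<open>
  The old variable is \<open>y i = f i * inverse (f i / y i)\<close>, a Laurent polynomial in the mutated cluster.
\<close>

lemma y_mem_L':
  assumes "i \<in> {1..n}" "k \<in> {1..N}" shows "y k \<in> L' i"
proof (cases "k = i")
  case True
  have "f i * inverse (f i / y i) \<in> L' i"
    using L'.mult_mem[OF f_mem_L'[OF assms(1)]] y'_unit_L'[OF assms(1)] unfolding unit_in_def by blast
  moreover have "f i * inverse (f i / y i) = y k" using True f_nonzero[OF assms(1)] by simp
  ultimately show ?thesis by simp
qed (use y_unit_L' assms in \<open>auto simp: unit_in_def\<close>)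

lemma P_subset_L':
  assumes "i \<in> {1..n}" shows "P \<subseteq> L' i"
proof (rule polynomials_in_least)
  show "R \<subseteq> L' i" using polynomials_in_base[of R y "{1..N} - {i}"] Pc_subset_L' by blast
  show "y ` {1..N} \<subseteq> L' i" using y_mem_L'[OF assms] by auto
qed (rule L'.field_subring_axioms)

lemma P_subset_S: "P \<subseteq> S"
  using P_subset_L P_subset_L' unfolding S_def by blast

text \<open>
  The mutated variable \<open>f i / y i\<close> is a unit of \<open>L' i\<close>, so \<open>y i\<close> and \<open>f i\<close> are associated there.
\<close>

lemma divide_y_iff_divide_f:
  assumes i: "i \<in> {1..n}" shows "a / y i \<in> L' i \<longleftrightarrow> a / f i \<in> L' i"
proof -
  have "a / f i = (a / y i) * inverse (f i / y i)" "a / y i = (a / f i) * (f i / y i)"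
    using f_nonzero[OF i] y_nonzero[OF index_mem[OF i]] by (auto simp: field_simps)
  thus ?thesis using y'_unit_L'[OF i] L'.mult_mem unfolding unit_in_def by metis
qed

text \<open>
  In all the Laurent rings except \<open>L' i\<close>, the element \<open>y i\<close> is invertible.
\<close>

lemma divide_y_mem_S_iff:
  assumes i: "i \<in> {1..n}" and a: "a \<in> S" shows "a / y i \<in> S \<longleftrightarrow> a / y i \<in> L' i"
proof -
  have "a / y i \<in> L" using L.unit_in_divide[OF y_unit_L] index_mem[OF i] a by (auto simp: S_def)
  moreover have "a / y i \<in> L' j" if "j \<in> {1..n}" "j \<noteq> i" for j
    using L'.unit_in_divide[OF y_unit_L'] index_mem[OF i] a that by (auto simp: S_def)
  ultimately show ?thesis using i unfolding S_def by blast
qed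

text \<open>
  Primality of \<open>f i\<close> descends from \<open>P\<close> to \<open>Pc i\<close>, ascends to the polynomial ring in the mutated cluster,
  and passes to the localization unless \<open>f i\<close> divides a monomial and becomes a unit.
\<close>

lemma f_prime_L':
  assumes i: "i \<in> {1..n}" and f: "prime_in P (f i)" "inverse (f i) \<notin> L' i"
  shows "prime_in (L' i) (f i)"
proof -
  let ?M = "polynomials_in R (y' i) {1..N}" and ?q = "\<Prod>k\<in>{1..N}. y' i k"
  interpret M: field_subring ?M by (rule polynomials_in_subring)
  note loc = L'_localization[OF i]
  have "prime_in (adjoin (Pc i) (y i)) (f i)" using f P_eq_adjoin[OF index_mem[OF i]] by simp
  hence "prime_in (Pc i) (f i)"
    by (rule Pc.prime_in_of_prime_in_adjoin[OF y_transcendental[OF index_mem[OF i]] f_mem[OF i]])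
  hence prime: "prime_in ?M (f i)"
    unfolding mutated_polynomials_eq_adjoin[OF i] by (rule Pc.prime_in_adjoin[OF y'_transcendental[OF i]])
  show ?thesis
  proof (cases "?q / f i \<in> ?M")
    case True
    hence "inverse (f i) * ?q ^ 1 \<in> ?M" by (simp add: field_simps)
    hence "inverse (f i) \<in> L' i" unfolding loc localization_def by blast
    thus ?thesis using f by simp
  next
    case False
    show ?thesis unfolding loc
    proof (rule prime_in_localization[OF M.field_subring_axioms _ _ prime False])
      show "?q \<in> ?M" by (intro M.prod_mem polynomials_in_variable)
      show "?q \<noteq> 0" using y'_nonzero[OF i] by simp
    qed
  qed
qed

lemma L_subset_L':
  assumes i: "i \<in> {1..n}" and f: "inverse (f i) \<in> L' i" shows "L \<subseteq> L' i"
proof (rule laurent_subring_least)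
  show "R \<subseteq> L' i" using polynomials_in_base[of R y "{1..N} - {i}"] Pc_subset_L' by blast
  fix k assume k: "k \<in> {1..N}"
  show "y k \<in> L' i" by (rule y_mem_L'[OF i k])
  show "inverse (y k) \<in> L' i"
    using y_unit_L'[OF k, of i] divide_y_iff_divide_f[OF i, of 1] f
    by (cases "k = i") (auto simp: unit_in_def divide_inverse)
qed (rule L'.field_subring_axioms)

lemma ufd_L': assumes i: "i \<in> {1..n}" shows "ufd (L' i)"
proof -
  let ?M = "polynomials_in R (y' i) {1..N}" and ?q = "\<Prod>k\<in>{1..N}. y' i k"
  interpret M: field_subring ?M by (rule polynomials_in_subring)
  have "ufd (Pc i)" by (rule ufd_polynomials_in[OF base independent]) auto
  hence "ufd ?M"
    unfolding mutated_polynomials_eq_adjoin[OF i] by (rule gauss_ufd_adjoin[OF _ y'_transcendental[OF i]])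
  thus ?thesis unfolding L'_localization[OF i]
    using y'_nonzero[OF i] by (intro ufd_localization M.prod_mem polynomials_in_variable) auto
qed

lemma ufd_P: "ufd P"
  by (rule ufd_polynomials_in[OF base independent]) auto

lemma L_localization: "L = localization P (\<Prod>k\<in>{1..N}. y k)"
  by (rule laurent_subring_localization[OF y_nonzero])

lemma ufd_L: "ufd L"
  unfolding L_localization
  using y_nonzero by (intro ufd_localization ufd_P P.prod_mem polynomials_in_variable) auto

text \<open>
  Nagata's theorem for \<open>L\<close> over \<open>S\<close>, with \<open>Q\<close> the set of those \<open>y i\<close> for which \<open>f i\<close> is not a unit of \<open>L' i\<close>.
  An element of \<open>L\<close> is multiplied into \<open>S\<close> by powers of these \<open>y i\<close>, one direction at a time. The exponent of \<open>y i\<close> in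
  a divisor is bounded because the same power of \<open>f i\<close> divides in the factorial ring \<open>L' i\<close>.
\<close>

theorem ufd_S_if_primes:
  assumes f: "\<And>i. i \<in> {1..n} \<Longrightarrow> prime_in P (f i)"
  shows "ufd S"
proof -
  define I where "I = {i \<in> {1..n}. inverse (f i) \<notin> L' i}"
  have I: "i \<in> {1..n}" "i \<in> {1..N}" "prime_in (L' i) (f i)" if "i \<in> I" for i
    using that f_prime_L'[OF _ f] index_mem by (auto simp: I_def)
  have y_prime_S: "prime_in S (y i)" if "i \<in> I" for i
    unfolding prime_in_def
  proof (intro conjI ballI impI)
    show "y i \<noteq> 0" using y_nonzero I[OF that] by auto
    show "y i \<in> S" using P_subset_S polynomials_in_variable I[OF that] by blast
    show "inverse (y i) \<notin> S"
      using divide_y_iff_divide_f[OF I(1)[OF that], of 1] I[OF that] that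
      by (auto simp: S_def I_def divide_inverse)
    fix a b assume ab: "a \<in> S" "b \<in> S" "a * b / y i \<in> S"
    have "a \<in> L' i" "b \<in> L' i" "a * b / y i \<in> L' i" using ab I(1)[OF that] unfolding S_def by blast+
    hence "a / f i \<in> L' i \<or> b / f i \<in> L' i"
      using prime_in_div[OF I(3)[OF that]] divide_y_iff_divide_f[OF I(1)[OF that]] by blast
    thus "a / y i \<in> S \<or> b / y i \<in> S"
      using divide_y_mem_S_iff[OF I(1)[OF that]] divide_y_iff_divide_f[OF I(1)[OF that]] ab by blast
  qed
  show ?thesis
  proof (rule nagata_ufd[where B = L and Q = "y ` I"])
    show "field_subring S" by (rule S.field_subring_axioms)
    show "ufd L" by (rule ufd_L)
    show "S \<subseteq> L" by (auto simp: S_def)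
    fix q assume q: "q \<in> y ` I"
    show "prime_in S q" using q y_prime_S by auto
    show "inverse q \<in> L" using q y_unit_L I by (auto simp: unit_in_def)
  next
    fix b assume b: "b \<in> L"
    let ?q = "\<Prod>k\<in>{1..N}. y k"
    have "finite I" by (auto simp: I_def)
    have qs: "\<exists>qs. set qs \<subseteq> y ` J \<and> prod_list qs * b \<in> (\<Inter>i\<in>J. L' i)" if "finite J" "J \<subseteq> I" for J
      using that
    proof induction
      case empty show ?case by (intro exI[of _ "[]"]) auto
    next
      case (insert i J)
      then obtain qs where qs: "set qs \<subseteq> y ` J" "\<And>j. j \<in> J \<Longrightarrow> prod_list qs * b \<in> L' j" by blast
      have i: "i \<in> {1..n}" "i \<in> {1..N}" using insert.prems I by auto
      obtain e where "b * ?q ^ e \<in> P" using b unfolding L_localization localization_def by blast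
      hence "b * ?q ^ e \<in> L' i" using P_subset_L'[OF i(1)] by blast
      moreover have "inverse (\<Prod>k\<in>{1..N} - {i}. y k) \<in> L' i"
        unfolding prod_inversef[symmetric] using y_unit_L' by (intro L'.prod_mem) (auto simp: unit_in_def)
      ultimately have "(b * ?q ^ e) * inverse (\<Prod>k\<in>{1..N} - {i}. y k) ^ e \<in> L' i"
        using L'.mult_mem L'.power_mem by blast
      moreover have "?q = y i * (\<Prod>k\<in>{1..N} - {i}. y k)"
        by (rule prod.remove[OF finite_atLeastAtMost i(2)])
      moreover have "(\<Prod>k\<in>{1..N} - {i}. y k) \<noteq> 0" using y_nonzero by simp
      ultimately have e: "y i ^ e * b \<in> L' i" by (simp add: field_simps power_inverse)
      have mem: "y k \<in> L' j" if "k \<in> insert i J" "j \<in> insert i J" for k j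
        using that insert.prems I y_mem_L' by blast
      have "prod_list (replicate e (y i) @ qs) * b \<in> L' j" if j: "j \<in> insert i J" for j
      proof (cases "j = i")
        case True
        have "prod_list qs \<in> L' i" using qs(1) mem by (intro L'.prod_list_mem) auto
        from L'.mult_mem[OF e this] show ?thesis using True by (simp add: ac_simps)
      next
        case False
        have "y i ^ e \<in> L' j" using mem[OF _ j] by (intro L'.power_mem) auto
        from L'.mult_mem[OF this qs(2)] False j show ?thesis by (simp add: ac_simps)
      qed
      thus ?case using qs(1) by (intro exI[of _ "replicate e (y i) @ qs"]) auto
    qed
    obtain qs where qs: "set qs \<subseteq> y ` I" "prod_list qs * b \<in> (\<Inter>i\<in>I. L' i)"
      using qs[OF \<open>finite I\<close>] by auto
    have mem: "prod_list qs * b \<in> L"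
      using qs(1) y_unit_L I b by (intro L.mult_mem L.prod_list_mem) (auto simp: unit_in_def)
    moreover have "prod_list qs * b \<in> L' i" if "i \<in> {1..n}" for i
      using that qs(2) L_subset_L'[OF that] mem by (cases "i \<in> I") (auto simp: I_def)
    ultimately show "\<exists>qs. set qs \<subseteq> y ` I \<and> prod_list qs * b \<in> S" using qs(1) by (auto simp: S_def)
  next
    fix a assume a: "a \<in> S" "a \<noteq> 0"
    have "\<exists>N. \<forall>e. a / f i ^ e \<in> L' i \<longrightarrow> e \<le> N" if i: "i \<in> I" for i
    proof -
      have "a \<in> L' i" using a I(1)[OF i] unfolding S_def by blast
      then obtain N where N: "\<And>qs. \<forall>q\<in>set qs. prime_in (L' i) q \<Longrightarrow> a / prod_list qs \<in> L' i \<Longrightarrow> length qs \<le> N"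
        using ufd_prime_divisors_bounded[OF ufd_L'[OF I(1)[OF i]] _ a(2)] by blast
      have "e \<le> N" if "a / f i ^ e \<in> L' i" for e
        using N[of "replicate e (f i)"] I(3)[OF i] that by auto
      thus ?thesis by blast
    qed
    then obtain B where B: "\<And>i e. i \<in> I \<Longrightarrow> a / f i ^ e \<in> L' i \<Longrightarrow> e \<le> B i" by metis
    \<comment> \<open>Needed to count the factors of a list by their index: \<open>y i\<close> is not invertible in \<open>L' i\<close>, every other variable is.\<close>
    have inj: "inj_on y I"
    proof (rule inj_onI, rule ccontr)
      fix i j assume ij: "i \<in> I" "j \<in> I" "y i = y j" "i \<noteq> j"
      have "inverse (y i) \<in> L' i" using y_unit_L'[OF I(2)[OF ij(2)], of i] ij by (auto simp: unit_in_def)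
      thus False using divide_y_iff_divide_f[OF I(1)[OF ij(1)], of 1] ij(1) by (auto simp: I_def divide_inverse)
    qed
    have "length qs \<le> (\<Sum>i\<in>I. B i)" if qs: "set qs \<subseteq> y ` I" "a / prod_list qs \<in> S" for qs
    proof -
      have "count_list qs (y i) \<le> B i" if i: "i \<in> I" for i
      proof (rule B[OF i])
        let ?e = "count_list qs (y i)"
        have split: "prod_list qs = y i ^ ?e * prod_list (filter (\<lambda>q. q \<noteq> y i) qs)"
          by (induction qs) (auto simp: ac_simps)
        have "prod_list (filter (\<lambda>q. q \<noteq> y i) qs) \<in> L' i"
          using qs(1) y_mem_L'[OF I(1)[OF i]] I by (intro L'.prod_list_mem) auto
        moreover have "a / prod_list qs \<in> L' i" using qs(2) I(1)[OF i] unfolding S_def by blast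
        ultimately have "(a / prod_list qs) * prod_list (filter (\<lambda>q. q \<noteq> y i) qs) \<in> L' i"
          by (rule L'.mult_mem[rotated])
        moreover have "prod_list (filter (\<lambda>q. q \<noteq> y i) qs) \<noteq> 0"
          using qs(1) y_nonzero I by (auto simp: prod_list_zero_iff)
        ultimately have "a / y i ^ ?e \<in> L' i" by (simp add: split)
        moreover have "inverse (f i / y i) ^ ?e \<in> L' i"
          using y'_unit_L'[OF I(1)[OF i]] by (intro L'.power_mem) (auto simp: unit_in_def)
        ultimately have "a / y i ^ ?e * inverse (f i / y i) ^ ?e \<in> L' i" by (rule L'.mult_mem)
        thus "a / f i ^ ?e \<in> L' i"
          using y_nonzero[OF I(2)[OF i]] by (simp add: power_divide)
      qed
      hence "(\<Sum>i\<in>I. count_list qs (y i)) \<le> (\<Sum>i\<in>I. B i)" by (rule sum_mono)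
      moreover have "(\<Sum>i\<in>I. count_list qs (y i)) = (\<Sum>q\<in>y ` I. count_list qs q)"
        by (simp add: sum.reindex[OF inj])
      moreover have "\<dots> = length qs"
        using qs(1) by (intro sum_count_set) (auto simp: I_def)
      ultimately show ?thesis by simp
    qed
    thus "\<exists>N. \<forall>qs. set qs \<subseteq> y ` I \<longrightarrow> a / prod_list qs \<in> S \<longrightarrow> length qs \<le> N" by blast
  qed
qed

text \<open>
  If \<open>h\<close> is invertible in \<open>L' i\<close>, then it divides a monomial in the mutated cluster. As \<open>h\<close> does not
  involve the \<open>i\<close>-th variable, comparing coefficients at powers of the mutated variable shows that \<open>h\<close> divides a monomial in the other
  variables. These are primes that do not divide \<open>h\<close>, so they can be cancelled.
\<close>

lemma inverse_mem_P_if_inverse_mem_L':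
  assumes i: "i \<in> {1..n}" and h: "h \<in> Pc i" "h \<noteq> 0" "inverse h \<in> L' i"
    and ndiv: "\<And>k. k \<in> {1..N} \<Longrightarrow> h / y k \<notin> P"
  shows "inverse h \<in> P"
proof -
  let ?M = "polynomials_in R (y' i) {1..N}" and ?Z = "\<Prod>k\<in>{1..N} - {i}. y k"
  have "(\<Prod>k\<in>{1..N}. y' i k) = y' i i * (\<Prod>k\<in>{1..N} - {i}. y' i k)"
    by (rule prod.remove[OF finite_atLeastAtMost index_mem[OF i]])
  also have "(\<Prod>k\<in>{1..N} - {i}. y' i k) = ?Z" by (intro prod.cong) auto
  finally have q: "(\<Prod>k\<in>{1..N}. y' i k) = (f i / y i) * ?Z" by simp
  obtain e where "inverse h * ((f i / y i) * ?Z) ^ e \<in> ?M"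
    using h(3) unfolding L'_localization[OF i] localization_def q by blast
  then obtain p where p: "p \<in> polys_over (Pc i)" "inverse h * ((f i / y i) * ?Z) ^ e = poly p (f i / y i)"
    unfolding mutated_polynomials_eq_adjoin[OF i] by (auto simp: adjoin_def)
  have Z: "?Z \<in> Pc i" by (intro Pc.prod_mem polynomials_in_variable)
  have "smult h p = monom (?Z ^ e) e"
  proof (rule Pc.transcendental_over_eqD[OF y'_transcendental[OF i]])
    show "smult h p \<in> polys_over (Pc i)" by (rule Pc.polys_over_smult[OF h(1) p(1)])
    show "monom (?Z ^ e) e \<in> polys_over (Pc i)" by (intro Pc.polys_over_monom Pc.power_mem Z)
    have "poly (smult h p) (f i / y i) = h * (inverse h * ((f i / y i) * ?Z) ^ e)" by (simp only: p(2) poly_smult)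
    also have "\<dots> = ((f i / y i) * ?Z) ^ e" using h(2) by (simp only: mult.assoc[symmetric] right_inverse[OF h(2)] mult_1_left)
    also have "\<dots> = poly (monom (?Z ^ e) e) (f i / y i)"
      unfolding poly_monom power_mult_distrib by (rule mult.commute)
    finally show "poly (smult h p) (f i / y i) = poly (monom (?Z ^ e) e) (f i / y i)" .
  qed
  hence "h * coeff p e = ?Z ^ e" by (metis coeff_monom coeff_smult)
  hence "?Z ^ e * inverse h = coeff p e" using h(2) by (auto simp: field_simps)
  hence *: "?Z ^ e * inverse h \<in> P" using polys_overD[OF p(1), of e] Pc_subset_P by auto
  obtain qs where qs: "set qs \<subseteq> y ` ({1..N} - {i})" "prod_list qs = ?Z ^ e"
    using power_prod_eq_prod_list[of "{1..N} - {i}" y e] by blast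
  show ?thesis
  proof (rule cancel_denominators[OF P.field_subring_axioms, of "y ` {1..N}" h _ qs])
    show "prod_list qs * inverse h \<in> P" using * qs by simp
    show "h \<in> P" using h Pc_subset_P by auto
    show "h * inverse h \<in> P" unfolding right_inverse[OF h(2)] by (rule P.one_mem)
  qed (use y_prime ndiv qs(1) h(2) in auto)
qed

text \<open>
  A unit of \<open>L\<close> is, up to a monomial, a divisor in \<open>P\<close> of a product of the primes \<open>y k\<close>.
\<close>

lemma unit_L_monomial:
  assumes a: "unit_in L a"
  obtains v \<alpha> where "unit_in P v" "a = v * (\<Prod>k\<in>{1..N}. y k powi \<alpha> k)"
proof -
  let ?q = "\<Prod>k\<in>{1..N}. y k"
  obtain e1 e2 where e: "a * ?q ^ e1 \<in> P" "inverse a * ?q ^ e2 \<in> P"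
    using a unfolding L_localization unit_in_def localization_def by blast
  obtain qs where qs: "set qs \<subseteq> y ` {1..N}" "prod_list qs = ?q ^ (e1 + e2)"
    using power_prod_eq_prod_list[of "{1..N}" y] by blast
  have "(a * ?q ^ e1) * (inverse a * ?q ^ e2) = prod_list qs"
    using a qs(2) by (simp add: unit_in_def power_add)
  then obtain v rs where v: "unit_in P v" "set rs \<subseteq> set qs" "a * ?q ^ e1 = v * prod_list rs"
    using divisor_of_prime_product[OF P.field_subring_axioms _ e] qs(1) y_prime by blast
  obtain \<beta> where \<beta>: "prod_list rs = (\<Prod>k\<in>{1..N}. y k ^ \<beta> k)"
    using prod_list_eq_power_prod[of "{1..N}" rs y] v(2) qs(1) by auto
  have "?q \<noteq> 0" using y_nonzero by simp
  hence "a = v * (prod_list rs / ?q ^ e1)" using v(3) by (simp add: field_simps)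
  also have "prod_list rs / ?q ^ e1 = (\<Prod>k\<in>{1..N}. y k powi (int (\<beta> k) - int e1))"
    unfolding \<beta> prod_power_distrib prod_dividef[symmetric]
    using y_nonzero by (intro prod.cong) (auto simp: power_int_diff)
  finally show ?thesis by (rule that[OF v(1)])
qed

text \<open>
  The factors \<open>a\<close> and \<open>b\<close> are units of \<open>L\<close>, thus Laurent monomials with exponents \<open>\<alpha>\<close> and \<open>\<beta>\<close> that add
  up to those of \<open>y i\<close>. If \<open>y k\<close> is not a unit of \<open>S\<close>, its exponent in a monomial in \<open>S\<close> cannot be negative,
  as otherwise \<open>y k\<close> would be invertible in \<open>L' k\<close>. So only \<open>y i\<close> occurs among these \<open>y k\<close>, and it occurs in one factor;
  the other factor is a product of units of \<open>S\<close>.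
\<close>

lemma y_irreducible_S:
  assumes i: "i \<in> {1..n}" "inverse (y i) \<notin> S" and ab: "a \<in> S" "b \<in> S" "y i = a * b"
  shows "inverse a \<in> S \<or> inverse b \<in> S"
proof -
  have i': "i \<in> {1..N}" by (rule index_mem[OF i(1)])
  have nz: "a \<noteq> 0" "b \<noteq> 0" using y_nonzero[OF i'] ab by auto
  have yS: "y k \<in> S" if "k \<in> {1..N}" for k
    using P_subset_S polynomials_in_variable[OF that] by blast
  have inv: "inverse a = inverse (y i) * b" "inverse b = inverse (y i) * a"
    using nz y_nonzero[OF i'] by (auto simp: ab(3) field_simps)
  have L: "a \<in> L" "b \<in> L" using ab by (auto simp: S_def)
  have unit: "unit_in L a"
    using nz L y_unit_L[OF i'] inv L.mult_mem by (auto simp: unit_in_def)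
  obtain v \<alpha> where v: "unit_in P v" "a = v * (\<Prod>k\<in>{1..N}. y k powi \<alpha> k)"
    using unit_L_monomial[OF unit] .
  have vS: "unit_in S v" using v(1) P_subset_S by (auto simp: unit_in_def)
  define \<beta> where "\<beta> k = (if k = i then 1 else 0) - \<alpha> k" for k
  have "(\<Prod>k\<in>{1..N}. y k powi (- \<alpha> k)) = inverse (\<Prod>k\<in>{1..N}. y k powi \<alpha> k)"
    by (simp add: power_int_minus prod_inversef[symmetric] o_def)
  hence "b = inverse v * (y i * (\<Prod>k\<in>{1..N}. y k powi (- \<alpha> k)))"
    using v nz ab(3) by (simp add: unit_in_def field_simps)
  also have "y i = (\<Prod>k\<in>{1..N}. if k = i then y i else 1)" using i' by simp
  also have "\<dots> * (\<Prod>k\<in>{1..N}. y k powi (- \<alpha> k)) = (\<Prod>k\<in>{1..N}. y k powi \<beta> k)"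
    unfolding prod.distrib[symmetric] using y_nonzero
    by (intro prod.cong) (auto simp: \<beta>_def power_int_diff power_int_minus divide_inverse)
  finally have b: "b = inverse v * (\<Prod>k\<in>{1..N}. y k powi \<beta> k)" .
  have vS': "unit_in S (inverse v)" by (rule S.unit_in_inverse[OF vS])
  have nonneg: "\<gamma> k \<ge> 0" if c: "w * (\<Prod>k\<in>{1..N}. y k powi \<gamma> k) \<in> S" "unit_in S w"
    and k: "k \<in> {1..N}" "inverse (y k) \<notin> S" for w \<gamma> k
  proof (rule ccontr)
    assume neg: "\<not> \<gamma> k \<ge> 0"
    \<comment> \<open>In every Laurent ring other than \<open>L' k\<close>, the element \<open>y k\<close> is invertible anyway.\<close>
    have "k \<in> {1..n} \<and> inverse (y k) \<notin> L' k"
    proof (rule ccontr)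
      assume *: "\<not> (k \<in> {1..n} \<and> inverse (y k) \<notin> L' k)"
      have "inverse (y k) \<in> L" using y_unit_L[OF k(1)] by (auto simp: unit_in_def)
      moreover have "inverse (y k) \<in> L' j" if "j \<in> {1..n}" for j
        using y_unit_L'[OF k(1), of j] * that by (cases "j = k") (auto simp: unit_in_def)
      ultimately show False using k(2) by (auto simp: S_def)
    qed
    hence k': "k \<in> {1..n}" "inverse (y k) \<notin> L' k" by auto
    let ?Z = "\<Prod>j\<in>{1..N} - {k}. y j powi \<gamma> j"
    have mem: "w * (\<Prod>k\<in>{1..N}. y k powi \<gamma> k) \<in> L' k" "inverse w \<in> L' k"
      using c k'(1) unfolding S_def unit_in_def by blast+
    have "inverse ?Z = (\<Prod>j\<in>{1..N} - {k}. y j powi (- \<gamma> j))" by (simp add: power_int_minus prod_inversef[symmetric] o_def)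
    also have "\<dots> \<in> L' k"
      using y_unit_L' by (intro L'.prod_mem L'.unit_in_power_int) auto
    finally have "inverse ?Z * (inverse w * (w * (\<Prod>k\<in>{1..N}. y k powi \<gamma> k))) \<in> L' k"
      using L'.mult_mem[OF _ L'.mult_mem[OF mem(2,1)]] by blast
    moreover have "?Z \<noteq> 0" "w \<noteq> 0" using y_nonzero c(2) by (auto simp: unit_in_def)
    moreover have "(\<Prod>k\<in>{1..N}. y k powi \<gamma> k) = y k powi \<gamma> k * ?Z"
      by (rule prod.remove[OF finite_atLeastAtMost k(1)])
    moreover have "inverse z * (inverse w * (w * (x * z))) = x" if "z \<noteq> 0" "w \<noteq> 0" for x z
      using that by (simp add: field_simps)
    ultimately have "y k powi \<gamma> k \<in> L' k" by metis
    \<comment> \<open>A negative power of \<open>y k\<close> is raised to the exponent \<open>-1\<close> by multiplying with \<open>y k\<close>.\<close>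
    moreover have "y k ^ nat (- \<gamma> k - 1) \<in> L' k" by (intro L'.power_mem y_mem_L' k k')
    ultimately have "y k powi \<gamma> k * y k powi (- \<gamma> k - 1) \<in> L' k"
      using neg L'.mult_mem by (simp add: power_int_def)
    moreover have "y k powi \<gamma> k * y k powi (- \<gamma> k - 1) = inverse (y k)"
      using y_nonzero[OF k(1)] by (simp flip: power_int_add)
    ultimately show False using k' by simp
  qed
  have invertible: "inverse (w * (\<Prod>k\<in>{1..N}. y k powi \<gamma> k)) \<in> S"
    if w: "unit_in S w" and zero: "\<And>k. k \<in> {1..N} \<Longrightarrow> inverse (y k) \<notin> S \<Longrightarrow> \<gamma> k = 0" for w \<gamma>
  proof -
    have "y k powi (- \<gamma> k) \<in> S" if k: "k \<in> {1..N}" for k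
    proof (cases "inverse (y k) \<in> S")
      case True
      hence "unit_in S (y k)" using yS y_nonzero k by (auto simp: unit_in_def)
      thus ?thesis by (rule S.unit_in_power_int)
    qed (use zero[OF k] in simp)
    hence "inverse w * (\<Prod>k\<in>{1..N}. y k powi (- \<gamma> k)) \<in> S"
      using w by (intro S.mult_mem S.prod_mem) (auto simp: unit_in_def)
    thus ?thesis by (simp add: power_int_minus prod_inversef[symmetric] o_def)
  qed
  have \<alpha>: "\<alpha> k \<ge> 0" and \<beta>: "\<beta> k \<ge> 0" if "k \<in> {1..N}" "inverse (y k) \<notin> S" for k
    using nonneg[OF _ vS that, of \<alpha>] nonneg[OF _ vS' that, of \<beta>] ab v b by auto
  consider "\<alpha> i = 0" | "\<beta> i = 0" using \<alpha>[OF i' i(2)] \<beta>[OF i' i(2)] by (force simp: \<beta>_def)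
  thus ?thesis
  proof cases
    case 1
    have "\<alpha> k = 0" if "k \<in> {1..N}" "inverse (y k) \<notin> S" for k
      using \<alpha>[OF that] \<beta>[OF that] 1 by (cases "k = i") (auto simp: \<beta>_def)
    thus ?thesis using invertible[OF vS, of \<alpha>] v by blast
  next
    case 2
    have "\<beta> k = 0" if "k \<in> {1..N}" "inverse (y k) \<notin> S" for k
      using \<alpha>[OF that] \<beta>[OF that] 2 by (cases "k = i") (auto simp: \<beta>_def)
    thus ?thesis using invertible[OF vS', of \<beta>] b by blast
  qed
qed

lemma factors_mem_Pc:
  assumes k: "k \<in> {1..N}" and "g \<in> P" "h \<in> P" "g * h \<in> Pc k" "g * h \<noteq> 0"
  shows "g \<in> Pc k"
proof -
  obtain p q where pq: "p \<in> polys_over (Pc k)" "q \<in> polys_over (Pc k)" "g = poly p (y k)" "h = poly q (y k)"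
    using assms unfolding P_eq_adjoin[OF k] by (auto simp: adjoin_def)
  have "p * q = [:g * h:]"
    using pq assms by (intro Pc.transcendental_over_eqD[OF y_transcendental[OF k]] Pc.polys_over_mult Pc.polys_over_const) auto
  moreover have "p \<noteq> 0" "q \<noteq> 0" using pq assms(5) by auto
  ultimately have "degree p + degree q = 0" by (metis degree_mult_eq degree_pCons_0)
  then obtain c where "p = [:c:]" by (metis add_is_0 degree_eq_zeroE)
  thus ?thesis using pq polys_overD[OF pq(1), of 0] by simp
qed

text \<open>
  If some variable divides \<open>f i\<close>, the two are associated. Otherwise \<open>y i\<close> is irreducible, hence prime, in
  \<open>S\<close>, and \<open>y i * (f i / y i) = g * h\<close> is an equation in \<open>S\<close>: if \<open>y i\<close> divides \<open>g\<close>, then \<open>g / f i = inverse h\<close> lies in \<open>L' i\<close>.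
\<close>

theorem prime_if_ufd_S:
  assumes S: "ufd S" and i: "i \<in> {1..n}" and nonunit: "inverse (f i) \<notin> P"
    and var: "\<And>k. k \<in> {1..N} \<Longrightarrow> f i / y k \<in> P \<Longrightarrow> y k / f i \<in> P"
  shows "prime_in P (f i)"
proof (cases "\<exists>k\<in>{1..N}. f i / y k \<in> P")
  case True
  then obtain k where k: "k \<in> {1..N}" "f i / y k \<in> P" by blast
  hence "unit_in P (f i / y k)" using var y_nonzero f_nonzero[OF i] by (auto simp: unit_in_def)
  from P.prime_in_unit_mult[OF y_prime[OF k(1)] this] show ?thesis using y_nonzero[OF k(1)] by simp
next
  case False
  have i': "i \<in> {1..N}" by (rule index_mem[OF i])
  have fnz: "f i \<noteq> 0" by (rule f_nonzero[OF i])
  have ynz: "y i \<noteq> 0" by (rule y_nonzero[OF i'])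
  have "inverse (f i) \<notin> L' i"
    using inverse_mem_P_if_inverse_mem_L'[OF i f_mem[OF i] fnz] False nonunit by blast
  hence yi: "inverse (y i) \<notin> S"
    using divide_y_iff_divide_f[OF i, of 1] i by (auto simp: S_def divide_inverse)
  have prime: "prime_in S (y i)"
  proof (rule ufd_irreducible_prime[OF S])
    show "y i \<in> S" using P_subset_S polynomials_in_variable[OF i'] by blast
  qed (use ynz yi y_irreducible_S[OF i yi] in auto)
  have fyS: "f i / y i \<in> S"
    using divide_y_mem_S_iff[OF i] f_mem_P[OF i] P_subset_S y'_unit_L'[OF i] by (auto simp: unit_in_def)
  show ?thesis
  proof (rule ufd_irreducible_prime[OF ufd_P f_mem_P[OF i] fnz nonunit])
    fix g h assume gh: "g \<in> P" "h \<in> P" "f i = g * h"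
    have cof: "inverse h \<in> P" if gh: "g \<in> P" "h \<in> P" "f i = g * h" and g: "g / y i \<in> S" for g h
    proof (rule inverse_mem_P_if_inverse_mem_L'[OF i])
      have nz: "g \<noteq> 0" "h \<noteq> 0" using fnz gh by auto
      show "h \<in> Pc i"
        using factors_mem_Pc[OF i' gh(2,1)] f_mem[OF i] fnz gh(3) by (simp add: mult.commute)
      show "h \<noteq> 0" by fact
      have "g / f i \<in> L' i" using g i divide_y_iff_divide_f[OF i] unfolding S_def by blast
      thus "inverse h \<in> L' i" using nz gh(3) by (simp add: field_simps)
      fix k assume k: "k \<in> {1..N}"
      show "h / y k \<notin> P"
      proof
        assume "h / y k \<in> P"
        from P.mult_mem[OF gh(1) this] show False using False k gh(3) by auto
      qed
    qed
    have "g / y i \<in> S \<or> h / y i \<in> S"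
      using prime_in_div[OF prime, of g h] gh P_subset_S fyS by auto
    thus "inverse g \<in> P \<or> inverse h \<in> P"
      using cof[of g h] cof[of h g] gh by (auto simp: mult.commute)
  qed
qed

end

section \<open>Translation to rings with a carrier set\<close>

lemma ring_on_simps [simp]:
  "carrier (ring_on A) = A" "(\<otimes>\<^bsub>ring_on A\<^esub>) = (*)" "\<one>\<^bsub>ring_on A\<^esub> = 1" "\<zero>\<^bsub>ring_on A\<^esub> = 0"
  "(\<oplus>\<^bsub>ring_on A\<^esub>) = (+)"
  by (simp_all add: ring_on_def ring_of_type_algebra_def fun_eq_iff)

lemma divides_ring_on: "a \<noteq> 0 \<Longrightarrow> a divides\<^bsub>ring_on A\<^esub> b \<longleftrightarrow> b / a \<in> A"
  by (auto simp: factor_def intro!: bexI[of _ "b / a"])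

lemma Units_ring_on: "Units (ring_on A) = {u. unit_in A u}"
proof (intro equalityI subsetI)
  fix u assume "u \<in> Units (ring_on A)"
  then obtain v where "u \<in> A" "v \<in> A" "u * v = 1" by (auto simp: Units_def)
  thus "u \<in> {u. unit_in A u}" using inverse_unique[of u v] by (auto simp: unit_in_def)
next
  fix u assume "u \<in> {u. unit_in A u}"
  thus "u \<in> Units (ring_on A)" by (auto simp: Units_def unit_in_def intro!: bexI[of _ "inverse u"])
qed

lemma domain_ring_on:
  fixes A :: "'f::field set"
  assumes "field_subring A" shows "domain (ring_on A)"
proof -
  interpret field_subring A by fact
  interpret amb: Ring.field "amb :: 'f ring" by (rule field_from_type_algebra)
  have "subring A amb" by (rule amb.subringI) (auto simp: uminus_mem add_mem mult_mem)
  hence "subdomain A amb" by (rule amb.subdomainI')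
  thus ?thesis unfolding ring_on_def by (rule amb.subdomain_is_domain)
qed

lemma ring_prime_ring_on_iff:
  assumes "p \<in> A" shows "ring_prime\<^bsub>ring_on A\<^esub> p \<longleftrightarrow> prime_in A p"
  using assms
  by (cases "p = 0") (auto simp: ring_prime_def Divisibility.prime_def prime_in_def Units_ring_on unit_in_def divides_ring_on)

lemma prime_in_ring_irreducible:
  assumes A: "field_subring A" and p: "prime_in A p"
  shows "ring_irreducible\<^bsub>ring_on A\<^esub> p"
proof -
  interpret domain "ring_on A" by (rule domain_ring_on[OF A])
  have p': "p \<noteq> 0" "p \<in> A" "inverse p \<notin> A" using prime_inD[OF p] by auto
  show ?thesis
  proof (rule ring_irreducibleI)
    fix a b assume "a \<in> carrier (ring_on A)" "b \<in> carrier (ring_on A)" "p = a \<otimes>\<^bsub>ring_on A\<^esub> b"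
    thus "a \<in> Units (ring_on A) \<or> b \<in> Units (ring_on A)"
      using prime_in_irreducible[OF A p, of a b] p' by (auto simp: Units_ring_on unit_in_def)
  qed (use p' in \<open>auto simp: Units_ring_on unit_in_def\<close>)
qed

lemma ufd_ring_irreducible_iff:
  assumes A: "ufd A" and "a \<in> A"
  shows "ring_irreducible\<^bsub>ring_on A\<^esub> a \<longleftrightarrow> prime_in A a"
proof
  interpret domain "ring_on A" by (rule domain_ring_on[OF ufd_subring[OF A]])
  assume "ring_irreducible\<^bsub>ring_on A\<^esub> a"
  note irr = ring_irreducibleE[OF _ this]
  have a: "a \<noteq> 0" "inverse a \<notin> A" using irr(1,4) assms(2) by (auto simp: Units_ring_on unit_in_def)
  show "prime_in A a"
  proof (rule ufd_irreducible_prime[OF A assms(2) a])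
    fix g h assume "g \<in> A" "h \<in> A" "a = g * h"
    thus "inverse g \<in> A \<or> inverse h \<in> A" using irr(5)[of g h] assms(2) by (auto simp: Units_ring_on unit_in_def)
  qed
qed (rule prime_in_ring_irreducible[OF ufd_subring[OF A]])

lemma foldr_mult_eq_prod_list: "foldr (*) ps (1 :: 'f::field) = prod_list ps"
  by (induction ps) auto

lemma factorial_domain_ring_on_iff:
  assumes A: "field_subring A" shows "factorial_domain (ring_on A) \<longleftrightarrow> ufd A"
proof
  assume "factorial_domain (ring_on A)"
  then interpret factorial_domain "ring_on A" .
  show "ufd A" unfolding ufd_def
  proof (intro conjI ballI impI A)
    fix a assume a: "a \<in> A" "a \<noteq> 0"
    show "\<exists>u ps. unit_in A u \<and> (\<forall>p\<in>set ps. prime_in A p) \<and> a = u * prod_list ps"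
    proof (cases "unit_in A a")
      case True thus ?thesis by (intro exI[of _ a] exI[of _ "[]"]) auto
    next
      case False
      then obtain fs where fs: "set fs \<subseteq> carrier (mult_of (ring_on A))" "factors (mult_of (ring_on A)) fs a"
        using factors_exist[of a] a by (auto simp: Units_ring_on)
      have "prime_in A p" if "p \<in> set fs" for p
      proof -
        have p: "p \<in> carrier (mult_of (ring_on A))" "Divisibility.irreducible (mult_of (ring_on A)) p"
          using fs that by (auto simp: factors_def)
        have "Divisibility.prime (mult_of (ring_on A)) p" 
          by (rule factorial_monoid.irreducible_prime[OF factorial_monoid_axioms p(2,1)])
        from ring_primeI'[OF _ this] p(1) show ?thesis using ring_prime_ring_on_iff[of p A] by auto
      qed
      moreover have "a = 1 * prod_list fs"
        using fs(2) by (simp add: factors_def foldr_mult_eq_prod_list[symmetric])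
      moreover have "unit_in A 1" using A field_subring.unit_in_one by blast
      ultimately show ?thesis by blast
    qed
  qed
next
  assume ufd: "ufd A"
  interpret field_subring A by (rule A)
  interpret domain "ring_on A" by (rule domain_ring_on[OF A])
  interpret primeness_condition_monoid "mult_of (ring_on A)"
  proof
    fix a assume a: "a \<in> carrier (mult_of (ring_on A))" "Divisibility.irreducible (mult_of (ring_on A)) a"
    hence "prime_in A a" using ring_irreducibleI'[of a] ufd_ring_irreducible_iff[OF ufd, of a] by auto
    thus "Divisibility.prime (mult_of (ring_on A)) a"
      using ring_primeE(2)[of a] ring_prime_ring_on_iff[of a A] a(1) by auto
  qed
  have "factorial_monoid (mult_of (ring_on A))"
  proof (rule mult_of.factorial_monoidI)
    fix a assume a: "a \<in> carrier (mult_of (ring_on A))"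
    then obtain u ps where u: "unit_in A u" "\<forall>p\<in>set ps. prime_in A p" "a = u * prod_list ps"
      using ufd_factor[OF ufd, of a] by auto
    have "Divisibility.irreducible (mult_of (ring_on A)) p" if "p \<in> set ps" for p
      using ring_irreducibleE(3)[OF _ prime_in_ring_irreducible[OF A, of p]] u(2) that prime_inD(2) by auto
    moreover have "prod_list ps \<sim>\<^bsub>mult_of (ring_on A)\<^esub> a"
      unfolding associated_def factor_def
    proof (intro conjI bexI)
      show "a = prod_list ps \<otimes>\<^bsub>mult_of (ring_on A)\<^esub> u" using u(3) by (simp add: mult.commute)
      show "prod_list ps = a \<otimes>\<^bsub>mult_of (ring_on A)\<^esub> inverse u" using u(1,3) by (simp add: unit_in_def)
    qed (use u(1) in \<open>auto simp: unit_in_def\<close>)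
    ultimately have "wfactors (mult_of (ring_on A)) ps a"
      by (simp add: wfactors_def foldr_mult_eq_prod_list)
    moreover have "set ps \<subseteq> carrier (mult_of (ring_on A))" using u(2) by (auto dest: prime_inD)
    ultimately show "\<exists>fs. set fs \<subseteq> carrier (mult_of (ring_on A)) \<and> wfactors (mult_of (ring_on A)) fs a" by blast
  qed (use wfactors_unique in auto)
  thus "factorial_domain (ring_on A)" by (intro factorial_domain.intro domain_axioms)
qed

section \<open>Factoriality of generalized upper cluster algebras\<close>

lemma mutation_equivalent_seed:
  "mutation_equivalent R n m d s t \<Longrightarrow> generalized_seed R n m d t"
  by (induction rule: mutation_equivalent.induct) auto

lemma skew_symmetrizable_diagonal:
  assumes "skew_symmetrizable n B" "i \<in> {1..n}" shows "B i i = 0"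
proof -
  obtain \<delta> :: "nat \<Rightarrow> int" where "\<delta> i > 0" "\<delta> i * B i i = - (\<delta> i * B i i)"
    using assms unfolding skew_symmetrizable_def by blast
  thus ?thesis by simp
qed

text \<open>
  The variable with index \<open>i\<close> has exponent \<open>0\<close> throughout, since the diagonal entry \<open>exmat t i i\<close>
  vanishes, and the coefficients are monomials in frozen variables.
\<close>

lemma exchange_poly_mem:
  assumes seed: "generalized_seed R n m d t" and i: "i \<in> {1..n}"
  shows "exchange_poly (n + m) d t i \<in> polynomials_in R (clu t) ({1..n+m} - {i})"
proof -
  let ?A = "polynomials_in R (clu t) ({1..n+m} - {i})"
  interpret A: field_subring ?A by (rule polynomials_in_subring)
  have diag: "exmat t i i = 0"
    using seed i skew_symmetrizable_diagonal unfolding generalized_seed_def by blast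
  have coef: "coef t i j \<in> ?A" if "j \<le> d i" for j
  proof (cases "j = 0 \<or> j = d i")
    case True
    hence "coef t i j = 1" using seed i unfolding generalized_seed_def by auto
    thus ?thesis using A.one_mem by metis
  next
    case False
    hence "frozen_monomial R n m (clu t) (coef t i j)"
      using seed i that unfolding generalized_seed_def by auto
    then obtain c a where c: "c \<in> R" "coef t i j = c * (\<Prod>k\<in>{n+1..n+m}. clu t k ^ a k)"
      unfolding frozen_monomial_def by blast
    moreover have "(\<Prod>k\<in>{n+1..n+m}. clu t k ^ a k) \<in> ?A"
      using i by (intro A.prod_mem A.power_mem polynomials_in_variable) auto
    ultimately show ?thesis
      unfolding c(2) using subsetD[OF polynomials_in_base c(1)] by (intro A.mult_mem)
  qed
  have mono: "clu t k ^ (j * nat (exmat t k i div int (d i)) + (d i - j) * nat (- (exmat t k i div int (d i)))) \<in> ?A"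
    if "k \<in> {1..n+m}" for k j
  proof (cases "k = i")
    case False
    thus ?thesis using that by (intro A.power_mem polynomials_in_variable) auto
  next
    case True
    thus ?thesis unfolding True diag using A.one_mem by (simp only: div_0 minus_zero nat_0 mult_0_right add_0 power_0)
  qed
  show ?thesis
    unfolding exchange_poly_def Let_def using coef mono
    by (intro A.sum_mem A.mult_mem A.prod_mem) auto
qed

theorem theorem4p12:
  fixes R :: "'f::field_char_0 set"
    and n m :: nat
    and d :: "nat \<Rightarrow> nat"
    and s t :: "'f gseed"
  assumes base_ring: "R = \<int> \<or> subfield R amb"
    and rank: "n + m > 0"
    and ambient: "rational_function_field R (n + m)"
    and degrees: "\<forall>i\<in>{1..n}. d i > 0"
    and seed: "generalized_seed R n m d s"
    and equiv: "mutation_equivalent R n m d s t"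
    and bound: "upper_cluster_algebra R n m d s = upper_bound R n m d t"
    and nonunit: "\<forall>i\<in>{1..n}. exchange_poly (n + m) d t i
                    \<notin> Units (ring_on (polynomial_subring R (n + m) (clu t)))"
    and no_variable_factor: "\<forall>i\<in>{1..n}. \<forall>k\<in>{1..n+m}.
           \<not> properfactor (ring_on (polynomial_subring R (n + m) (clu t)))
               (clu t k) (exchange_poly (n + m) d t i)"
  shows "factorial_domain (ring_on (upper_cluster_algebra R n m d s)) \<longleftrightarrow>
         (\<forall>i\<in>{1..n}. ring_irreducible\<^bsub>ring_on (polynomial_subring R (n + m) (clu t))\<^esub>
                        (exchange_poly (n + m) d t i))"
proof -
  let ?y = "clu t" and ?f = "exchange_poly (n + m) d t"
  let ?P = "polynomials_in R ?y {1..n+m}"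
  have P: "polynomial_subring R (n + m) ?y = ?P"
    by (simp add: polynomial_subring_def polynomials_in_def)
  have base: "ufd R" using base_ring ufd_Ints ufd_subfield by blast
  have t: "generalized_seed R n m d t" by (rule mutation_equivalent_seed[OF equiv])
  hence ind: "alg_independent R (n + m) ?y" by (simp add: generalized_seed_def)
  have "transcendental_over (polynomials_in R ?y {}) (?y k)" if "k \<in> {1..n+m}" for k
    using alg_independent_transcendental[OF ufd_subring[OF base] ind _ that] by auto
  hence ynz: "?y k \<noteq> 0" if "k \<in> {1..n+m}" for k
    using field_subring.transcendental_over_nonzero[OF polynomials_in_subring] that by blast
  \<comment> \<open>As \<open>n + m > 0\<close>, there is a variable, and \<open>0\<close> is a proper multiple of it.\<close>
  have fnz: "?f i \<noteq> 0" if i: "i \<in> {1..n}" for i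
  proof
    assume zero: "?f i = 0"
    have "1 \<in> {1..n+m}" using rank by auto
    moreover have "properfactor (ring_on ?P) (?y 1) 0"
      using ynz[OF \<open>1 \<in> {1..n+m}\<close>] field_subring.zero_mem[OF polynomials_in_subring]
      by (auto simp: properfactor_def divides_ring_on factor_def)
    ultimately show False using no_variable_factor i zero P by metis
  qed
  interpret exchange_data R n "n + m" ?y ?f
    using base ind exchange_poly_mem[OF t] fnz by unfold_locales auto
  have S: "upper_cluster_algebra R n m d s = S"
    unfolding bound upper_bound_def S_def L'_def y'_def mutate_def by simp
  have nonunit': "inverse (?f i) \<notin> ?P" if "i \<in> {1..n}" for i
    using nonunit that fnz f_mem_P unfolding P Units_ring_on unit_in_def by blast
  have variable': "?y k / ?f i \<in> ?P" if "i \<in> {1..n}" "k \<in> {1..n+m}" "?f i / ?y k \<in> ?P" for i k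
    using no_variable_factor that fnz ynz unfolding P properfactor_def by (auto simp: divides_ring_on)
  have "factorial_domain (ring_on S) \<longleftrightarrow> (\<forall>i\<in>{1..n}. prime_in ?P (?f i))"
    unfolding factorial_domain_ring_on_iff[OF S.field_subring_axioms]
    using ufd_S_if_primes prime_if_ufd_S nonunit' variable' by blast
  also have "\<dots> \<longleftrightarrow> (\<forall>i\<in>{1..n}. ring_irreducible\<^bsub>ring_on ?P\<^esub> (?f i))"
    using ufd_ring_irreducible_iff[OF ufd_P f_mem_P] by blast
  finally show ?thesis unfolding S P .
qed

end
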